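(* Let $M$ be a gasket automaton satisfying the $\gamma$-isolated condition and with $\mathcal P_{\alpha\gamma}\cup\mathcal P_{\beta\gamma}\neq\emptyset$, and let $M'$ be a one-step simplification of $M$. Then for every $\xi\in(0,1)$ the pseudo-metric spaces $(\mathcal A_M,\tilde\rho_{M,\xi})$ and $(\mathcal A_{M'},\tilde\rho_{M',\xi})$ are Lipschitz equivalent, i.e. there is a bijection $f:\mathcal A_M\to\mathcal A_{M'}$ and $C>0$ with $C^{-1}\tilde\rho_{M,\xi}(a,b)\le\tilde\rho_{M',\xi}(f(a),f(b))\le C\tilde\rho_{M,\xi}(a,b)$ for all $a,b\in\mathcal A_M$.
   Context: $\Sigma=\{1,\dots,N\}$, $\Sigma^\infty$ the infinite words over $\Sigma$. A $\Sigma$-automaton $M$ has finite state set $Q=Q_0\cup\{Id,Exit\}$, input alphabet $\Sigma^2$, initial state $Id$, final state $Exit$, transition $\delta:Q\times\Sigma^2\to Q$ with $\delta(Id,(i,j))=Id$ iff $i=j$. Itinerary of $(\mathbf x,\mathbf y)$: $S_0=Id$, $S_k=\delta(S_{k-1},(x_k,y_k))$, stopped at $Exit$; surviving time $T_M(\mathbf x,\mathbf y)$ = largest $k$ with $S_k\ne Exit$ (possibly $\infty$); $\rho_{M,\xi}(\mathbf x,\mathbf y)=\xi^{T_M(\mathbf x,\mathbf y)}$ ($\xi^\infty=0$). For a gasket automaton, $\rho_{M,\xi}$ is symmetric, vanishes on the diagonal and satisfies $\rho(\mathbf x,\mathbf z)\le C(\rho(\mathbf x,\mathbf y)+\rho(\mathbf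 y,\mathbf z))$; set $\mathbf x\sim\mathbf y$ iff $\rho_{M,\xi}(\mathbf x,\mathbf y)=0$, $\mathcal A_M=\Sigma^\infty/\sim$, and $\tilde\rho_{M,\xi}([\mathbf x],[\mathbf y])=\inf\{\rho_{M,\xi}(\mathbf a,\mathbf b):\mathbf a\in[\mathbf x],\mathbf b\in[\mathbf y]\}$. Triangle automaton: $\alpha,\beta,\gamma$ distinct elements of $\Sigma\cup\{-1,-2,-3\}$; $Q=\{S_{uv}:u\neq v\in\{\alpha,\beta,\gamma\}\}\cup\{Id,Exit\}$; (i) $\delta(Id,(i,j))=S_{uv}\Rightarrow\delta(Id,(j,i))=S_{vu}$; (ii) $\delta(S_{uv},(i,j))=S_{uv}$ if $(i,j)=(v,u)$, else $Exit$. $\mathcal P_{uv}=\{(i,j):\delta(Id,(i,j))=S_{uv}\}$; $i\triangleleft_{uv}j$ iff $(i,j)\in\mathcal P_{uv}$ (equivalently $j\triangleleft_{vu}i$). $j$ is $uv$-minimal if no $i\triangleleft_{uv}j$, $uv$-maximal if no $j\triangleleft_{uv}k$, $uv$-isolated if both. A triangle automaton is thus determined by $\mathcal P_{\alpha\beta},\mathcal P_{\alpha\gamma},\mathcal P_{\beta\gamma}$. Gasket automaton: triangle automaton with (Uniqueness) $i\triangleleft_{uv}j,i\triangleleft_{uv}j'\Rightarrow j=j'$; (Gathering) any two of $a\triangleleft_{\alpha\gamma}c$, $a\triangleleft_{\beta\gamma}b$, $b\triangleleft_{\alpha\beta}c$ imply the third; (Boundary) if $\alpha\in\Sigma$ it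 is $\alpha\gamma$- and $\alpha\beta$-minimal; if $\beta\in\Sigma$ it is $\beta\gamma$- and $\beta\alpha$-minimal; if $\gamma\in\Sigma$ it is $\gamma\alpha$- and $\gamma\beta$-minimal. $\gamma$-isolated condition: $\alpha,\beta,\gamma\in\Sigma$; the directed graph on $\Sigma$ with edge set $\mathcal P_{\alpha\gamma}\cup\mathcal P_{\beta\gamma}$ has no directed cycle; $\gamma$ is $\alpha\gamma$-, $\beta\gamma$- and $\alpha\beta$-isolated. One-step simplification: $b$ is double-maximal if it is $\alpha\gamma$-maximal and $\beta\gamma$-maximal. Choose $(\tau,\kappa)\in\mathcal P_{\alpha\gamma}\cup\mathcal P_{\beta\gamma}$ with $\kappa$ double-maximal. If $(\tau,\kappa)\in\mathcal P_{\alpha\gamma}$: when $\kappa$ has no $\alpha\beta$-predecessor set $\mathcal P'_{\alpha\beta}=\mathcal P_{\alpha\beta}$, $\mathcal P'_{\alpha\gamma}=\mathcal P_{\alpha\gamma}\setminus\{(\tau,\kappa)\}$, $\mathcal P'_{\beta\gamma}=\mathcal P_{\beta\gamma}$; when $\kappa$ has an $\alpha\beta$-predecessor $\lambda$ (i.e. $\lambda\triangleleft_{\alpha\beta}\kappa$) set $\mathcal P'_{\alpha\beta}=\mathcal P_{\alpha\beta}$, $\mathcal P'_{\alpha\gamma}=\mathcal P_{\alpha\gamma}\setminus\{(\tau,\kappa)\}$, $\mathcal P'_{\beta\gamma}=\mathcal P_{\beta\gamma}\setminus\{(\tau,\lambda)\}$. If $(\tau,\kappa)\in\mathcal P_{\beta\gamma}$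 the definition is the same with the roles of $\alpha$ and $\beta$ interchanged. $M'$ is the triangle automaton determined by $\mathcal P'_{\alpha\beta},\mathcal P'_{\alpha\gamma},\mathcal P'_{\beta\gamma}$. *)

theory Defs
  imports Main "HOL-Library.Extended_Nat"
begin

(* Alphabet Sigma = {1..N}; letters and the labels alpha, beta, gamma are integers
   (labels may also be -1,-2,-3).  Infinite words x_1 x_2 ... are functions nat => int,
   with x_{k+1} = x k. *)

record tri =
  sz  :: nat
  al  :: int
  be  :: int
  ga  :: int
  Pab :: "(int \<times> int) set"
  Pag :: "(int \<times> int) set"
  Pbg :: "(int \<times> int) set"

definition Sig :: "tri \<Rightarrow> int set" where
  "Sig M = {1..int (sz M)}"

definition words :: "tri \<Rightarrow> (nat \<Rightarrow> int) set" where
  "words M = {x. \<forall>k. x k \<in> Sig M}"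

definition Puv :: "tri \<Rightarrow> int \<Rightarrow> int \<Rightarrow> (int \<times> int) set" where
  "Puv M u v =
    (if (u, v) = (al M, be M) then Pab M
     else if (u, v) = (be M, al M) then converse (Pab M)
     else if (u, v) = (al M, ga M) then Pag M
     else if (u, v) = (ga M, al M) then converse (Pag M)
     else if (u, v) = (be M, ga M) then Pbg M
     else if (u, v) = (ga M, be M) then converse (Pbg M)
     else {})"

definition labels :: "tri \<Rightarrow> int set" where
  "labels M = {al M, be M, ga M}"

definition triangle_aut :: "tri \<Rightarrow> bool" where
  "triangle_aut M \<longleftrightarrow>
     distinct [al M, be M, ga M] \<and>
     labels M \<subseteq> Sig M \<union> {-1, -2, -3} \<and>
     (\<forall>u\<in>labels M. \<forall>v\<in>labels M. u \<noteq> v \<longrightarrow>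
        Puv M u v \<subseteq> Sig M \<times> Sig M \<and> Puv M u v \<inter> Id = {}) \<and>
     (\<forall>u\<in>labels M. \<forall>v\<in>labels M. \<forall>u'\<in>labels M. \<forall>v'\<in>labels M.
        u \<noteq> v \<longrightarrow> u' \<noteq> v' \<longrightarrow> (u, v) \<noteq> (u', v') \<longrightarrow> Puv M u v \<inter> Puv M u' v' = {})"

datatype state = IdS | ExitS | S int int

definition delta_Id :: "tri \<Rightarrow> int \<Rightarrow> int \<Rightarrow> state" where
  "delta_Id M i j =
    (if i = j then IdS
     else if (i, j) \<in> Puv M (al M) (be M) then S (al M) (be M)
     else if (i, j) \<in> Puv M (be M) (al M) then S (be M) (al M)
     else if (i, j) \<in> Puv M (al M) (ga M) then S (al M) (ga M)
     else if (i, j) \<in> Puv M (ga M) (al M) then S (ga M) (al M)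
     else if (i, j) \<in> Puv M (be M) (ga M) then S (be M) (ga M)
     else if (i, j) \<in> Puv M (ga M) (be M) then S (ga M) (be M)
     else ExitS)"

fun delta :: "tri \<Rightarrow> state \<Rightarrow> int \<Rightarrow> int \<Rightarrow> state" where
  "delta M IdS i j = delta_Id M i j"
| "delta M (S u v) i j = (if (i, j) = (v, u) then S u v else ExitS)"
| "delta M ExitS i j = ExitS"

fun itin :: "tri \<Rightarrow> (nat \<Rightarrow> int) \<Rightarrow> (nat \<Rightarrow> int) \<Rightarrow> nat \<Rightarrow> state" where
  "itin M x y 0 = IdS"
| "itin M x y (Suc k) = delta M (itin M x y k) (x k) (y k)"

definition surv :: "tri \<Rightarrow> (nat \<Rightarrow> int) \<Rightarrow> (nat \<Rightarrow> int) \<Rightarrow> enat" where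
  "surv M x y =
    (if \<forall>k. itin M x y k \<noteq> ExitS then \<infinity>
     else enat (GREATEST k. itin M x y k \<noteq> ExitS))"

definition rho :: "tri \<Rightarrow> real \<Rightarrow> (nat \<Rightarrow> int) \<Rightarrow> (nat \<Rightarrow> int) \<Rightarrow> real" where
  "rho M \<xi> x y = (case surv M x y of enat n \<Rightarrow> \<xi> ^ n | \<infinity> \<Rightarrow> 0)"

definition simrel :: "tri \<Rightarrow> real \<Rightarrow> ((nat \<Rightarrow> int) \<times> (nat \<Rightarrow> int)) set" where
  "simrel M \<xi> = {(x, y). x \<in> words M \<and> y \<in> words M \<and> rho M \<xi> x y = 0}"

definition AM :: "tri \<Rightarrow> real \<Rightarrow> (nat \<Rightarrow> int) set set" where
  "AM M \<xi> = words M // simrel M \<xi>"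

definition rho_t :: "tri \<Rightarrow> real \<Rightarrow> (nat \<Rightarrow> int) set \<Rightarrow> (nat \<Rightarrow> int) set \<Rightarrow> real" where
  "rho_t M \<xi> X Y = Inf {rho M \<xi> a b | a b. a \<in> X \<and> b \<in> Y}"

definition minimal :: "tri \<Rightarrow> int \<Rightarrow> int \<Rightarrow> int \<Rightarrow> bool" where
  "minimal M u v j \<longleftrightarrow> \<not> (\<exists>i. (i, j) \<in> Puv M u v)"

definition maximal :: "tri \<Rightarrow> int \<Rightarrow> int \<Rightarrow> int \<Rightarrow> bool" where
  "maximal M u v j \<longleftrightarrow> \<not> (\<exists>k. (j, k) \<in> Puv M u v)"

definition isolated :: "tri \<Rightarrow> int \<Rightarrow> int \<Rightarrow> int \<Rightarrow> bool" where
  "isolated M u v j \<longleftrightarrow> minimal M u v j \<and> maximal M u v j"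

definition gasket_aut :: "tri \<Rightarrow> bool" where
  "gasket_aut M \<longleftrightarrow> triangle_aut M \<and>
    (\<forall>u\<in>labels M. \<forall>v\<in>labels M. u \<noteq> v \<longrightarrow>
       (\<forall>i j j'. (i, j) \<in> Puv M u v \<and> (i, j') \<in> Puv M u v \<longrightarrow> j = j')) \<and>
    (\<forall>a b c.
       let p = (a, c) \<in> Puv M (al M) (ga M);
           q = (a, b) \<in> Puv M (be M) (ga M);
           r = (b, c) \<in> Puv M (al M) (be M)
       in (p \<and> q \<longrightarrow> r) \<and> (p \<and> r \<longrightarrow> q) \<and> (q \<and> r \<longrightarrow> p)) \<and>
    (al M \<in> Sig M \<longrightarrow> minimal M (al M) (ga M) (al M) \<and> minimal M (al M) (be M) (al M)) \<and>
    (be M \<in> Sig M \<longrightarrow> minimal M (be M) (ga M) (be M) \<and> minimal M (be M) (al M) (be M)) \<and>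
    (ga M \<in> Sig M \<longrightarrow> minimal M (ga M) (al M) (ga M) \<and> minimal M (ga M) (be M) (ga M))"

definition gamma_isolated :: "tri \<Rightarrow> bool" where
  "gamma_isolated M \<longleftrightarrow>
    al M \<in> Sig M \<and> be M \<in> Sig M \<and> ga M \<in> Sig M \<and>
    acyclic (Puv M (al M) (ga M) \<union> Puv M (be M) (ga M)) \<and>
    isolated M (al M) (ga M) (ga M) \<and> isolated M (be M) (ga M) (ga M) \<and>
    isolated M (al M) (be M) (ga M)"

definition double_max :: "tri \<Rightarrow> int \<Rightarrow> bool" where
  "double_max M b \<longleftrightarrow> maximal M (al M) (ga M) b \<and> maximal M (be M) (ga M) b"

definition one_step_simp :: "tri \<Rightarrow> tri \<Rightarrow> bool" where
  "one_step_simp M M' \<longleftrightarrow>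
    (\<exists>\<tau> \<kappa>. double_max M \<kappa> \<and>
      (((\<tau>, \<kappa>) \<in> Puv M (al M) (ga M) \<and>
         (((\<nexists>lam. (lam, \<kappa>) \<in> Puv M (al M) (be M)) \<and>
            M' = M\<lparr>Pag := Pag M - {(\<tau>, \<kappa>)}\<rparr>) \<or>
          (\<exists>lam. (lam, \<kappa>) \<in> Puv M (al M) (be M) \<and>
            M' = M\<lparr>Pag := Pag M - {(\<tau>, \<kappa>)}, Pbg := Pbg M - {(\<tau>, lam)}\<rparr>))) \<or>
       ((\<tau>, \<kappa>) \<in> Puv M (be M) (ga M) \<and>
         (((\<nexists>lam. (lam, \<kappa>) \<in> Puv M (be M) (al M)) \<and>
            M' = M\<lparr>Pbg := Pbg M - {(\<tau>, \<kappa>)}\<rparr>) \<or>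
          (\<exists>lam. (lam, \<kappa>) \<in> Puv M (be M) (al M) \<and>
            M' = M\<lparr>Pbg := Pbg M - {(\<tau>, \<kappa>)}, Pag := Pag M - {(\<tau>, lam)}\<rparr>)))))"

definition lipschitz_equiv ::
  "'a set \<Rightarrow> ('a \<Rightarrow> 'a \<Rightarrow> real) \<Rightarrow> 'b set \<Rightarrow> ('b \<Rightarrow> 'b \<Rightarrow> real) \<Rightarrow> bool" where
  "lipschitz_equiv A d B d' \<longleftrightarrow>
    (\<exists>f C. bij_betw f A B \<and> C > 0 \<and>
       (\<forall>a\<in>A. \<forall>b\<in>A. d a b / C \<le> d' (f a) (f b) \<and> d' (f a) (f b) \<le> C * d a b))"

end

(* Encode a point w i v v v ... by its cell letter and corner (i, v); the automaton glues
   i v^inf to j u^inf exactly if (i, j) lies in P_uv.  The simplification M' detaches the point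
   (tau, gamma) from its class, which contains (kappa, alpha).
   The cells kappa alpha^j kappa gamma accumulate at kappa alpha^inf and are isolated, because
   kappa is double-maximal and the cell gamma touches nothing.  For each length L >= 3, the L - 2
   words tau gamma^(L-1) and kappa alpha^j kappa gamma^(L-2-j), 1 <= j <= L - 3, are permuted
   cyclically, and this rewriting is applied to every maximal such block of an infinite word.  A block
   tau gamma^m, which is close to tau gamma^inf, is thereby exchanged with a block close to
   kappa alpha^inf.  Lengths are preserved, so surviving times change by a bounded amount. *)
theory Submission
  imports Defs
begin

section \<open>Words and glued corners\<close>

text \<open>The torn-off point tau gamma^inf is free in M', so a free point of M must take its
  place. At infinite length the cycle opens into a one-sided shift: toward M', kappa alpha kappa
  gamma^inf, glued to nothing, becomes tau gamma^inf, each later kappa alpha^j kappa gamma^inf moves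
  down by one, and tau gamma^inf goes to kappa alpha^inf, its glued partner. The map on words toward
  M' is thus not injective, but the map on classes is bijective. Two obstacles shape the proof.
  Undoing the rewriting requires that the rewritten word has the same blocks in the same places;
  this holds because each output starts with tau gamma or kappa alpha, so no new block can arise.
  Since tau = alpha is possible, one letter does not settle this and pairs of letters are compared.
  Secondly, losses of surviving time must not add up over the blocks: a loss occurs only where two
  words part, and there it is at most 7. Both directions are instances of one statement with the two
  gluings exchanged.\<close>

definition agree :: "nat \<Rightarrow> (nat \<Rightarrow> 'a) \<Rightarrow> (nat \<Rightarrow> 'a) \<Rightarrow> bool" where
  "agree n x y \<longleftrightarrow> (\<forall>l<n. x l = y l)"

definition shift :: "nat \<Rightarrow> (nat \<Rightarrow> 'a) \<Rightarrow> nat \<Rightarrow> 'a" where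
  "shift n x = (\<lambda>m. x (n + m))"

definition corner :: "'a \<times> 'a \<Rightarrow> nat \<Rightarrow> 'a" where
  "corner a = (\<lambda>n. if n = 0 then fst a else snd a)"

text \<open>Automaton-free form of "the itinerary is alive at time \<open>k\<close>":
  \<open>n\<close> is a time up to which it stays in the identity state, after which the two words
  run along glued corners.\<close>

definition survives ::
  "(('a \<times> 'a) \<times> ('a \<times> 'a)) set \<Rightarrow> nat \<Rightarrow> (nat \<Rightarrow> 'a) \<Rightarrow> (nat \<Rightarrow> 'a) \<Rightarrow> bool" where
  "survives R k x y \<longleftrightarrow> (\<exists>n. agree n x y \<and>
     (k \<le> n \<or> (\<exists>(a, b)\<in>R. agree (k - n) (shift n x) (corner a) \<and> agree (k - n) (shift n y) (corner b))))"

lemma agree_mono: "agree n x y \<Longrightarrow> m \<le> n \<Longrightarrow> agree m x y"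
  by (simp add: agree_def)

lemma agree_refl [simp]: "agree n x x"
  by (simp add: agree_def)

lemma agree_0 [simp]: "agree 0 x y"
  by (simp add: agree_def)

lemma agree_sym: "agree n x y \<Longrightarrow> agree n y x"
  by (simp add: agree_def)

lemma agree_trans: "agree n x y \<Longrightarrow> agree n y z \<Longrightarrow> agree n x z"
  by (simp add: agree_def)

lemma agree_Suc: "agree (Suc n) x y \<longleftrightarrow> x 0 = y 0 \<and> agree n (shift 1 x) (shift 1 y)"
  by (auto simp: agree_def shift_def less_Suc_eq_0_disj)

lemma shift_shift [simp]: "shift m (shift n x) = shift (n + m) x"
  by (simp add: shift_def add.assoc)

lemma shift_0 [simp]: "shift 0 x = x"
  by (simp add: shift_def)

lemma shift_nth: "shift n x m = x (n + m)"
  by (simp add: shift_def)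

lemma corner_0 [simp]: "corner a 0 = fst a"
  by (simp add: corner_def)

lemma corner_pos [simp]: "0 < n \<Longrightarrow> corner a n = snd a"
  by (simp add: corner_def)

lemma survives_agree: "agree k x y \<Longrightarrow> survives R k x y"
  unfolding survives_def by blast

lemma survives_0 [simp]: "survives R 0 x y"
  by (simp add: survives_agree)

lemma survives_cases:
  assumes "survives R k x y"
  obtains n where "agree n x y" "k \<le> n"
  | n a b where "n < k" "agree n x y" "(a, b) \<in> R"
      "agree (k - n) (shift n x) (corner a)" "agree (k - n) (shift n y) (corner b)"
proof -
  obtain n where n: "agree n x y" "k \<le> n \<or> (\<exists>(a, b)\<in>R. agree (k - n) (shift n x) (corner a) \<and>
      agree (k - n) (shift n y) (corner b))"
    using assms unfolding survives_def by blast
  then consider "k \<le> n" | a b where "n < k" "(a, b) \<in> R" "agree (k - n) (shift n x) (corner a)"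
      "agree (k - n) (shift n y) (corner b)"
    by fastforce
  then show ?thesis using that n(1) by cases auto
qed

lemma survives_adjacent:
  assumes "agree n x y" "(a, b) \<in> R"
    "agree (k - n) (shift n x) (corner a)" "agree (k - n) (shift n y) (corner b)"
  shows "survives R k x y"
  using assms unfolding survives_def by blast

lemma survives_mono:
  assumes "survives R k x y" "m \<le> k"
  shows "survives R m x y"
  using assms(1)
proof (cases rule: survives_cases)
  case (1 n)
  then show ?thesis using assms(2) by (intro survives_agree) (auto elim: agree_mono)
next
  case (2 n a b)
  have "m - n \<le> k - n" using assms(2) by simp
  then show ?thesis using survives_adjacent[OF 2(2,3)] 2(4,5) agree_mono by blast
qed

lemma survives_sym:
  assumes "sym R" "survives R k x y"
  shows "survives R k y x"
  using assms(2)
proof (cases rule: survives_cases)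
  case (1 n)
  then show ?thesis by (intro survives_agree) (auto elim: agree_mono dest: agree_sym)
next
  case (2 n a b)
  then show ?thesis
    using survives_adjacent[OF agree_sym[OF 2(2)] symD[OF assms(1) 2(3)]] by blast
qed

lemma agree_append:
  assumes "agree L x y" "agree n (shift L x) (shift L y)"
  shows "agree (L + n) x y"
  unfolding agree_def
proof (intro allI impI)
  fix l assume "l < L + n"
  then show "x l = y l"
    using assms(1) assms(2)[unfolded agree_def, rule_format, of "l - L"]
    by (cases "l < L") (simp_all add: agree_def shift_def)
qed

lemma survives_prepend:
  assumes "agree L x y" "survives R (k - L) (shift L x) (shift L y)"
  shows "survives R k x y"
  using assms(2)
proof (cases rule: survives_cases)
  case (1 n)
  then show ?thesis
    using agree_mono[OF agree_append[OF assms(1) 1(1)], of k] by (intro survives_agree) simp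
next
  case (2 n a b)
  then show ?thesis
    using survives_adjacent[OF agree_append[OF assms(1) 2(2)] 2(3), of k] by simp
qed

text \<open>Glued corners have different first letters, so words that agree for \<open>L\<close>
  letters cannot branch before \<open>L\<close>; the branching survives the shift.\<close>

lemma survives_shift:
  assumes "\<And>a b. (a, b) \<in> R \<Longrightarrow> fst a \<noteq> fst b" "agree L x y" "survives R k x y"
  shows "survives R (k - L) (shift L x) (shift L y)"
  using assms(3)
proof (cases rule: survives_cases)
  case (1 n)
  then show ?thesis by (intro survives_agree) (auto simp: agree_def shift_def)
next
  case (2 n a b)
  have "x n = fst a" "y n = fst b"
    using 2(1) 2(4,5)[unfolded agree_def, rule_format, of 0] by (simp_all add: shift_def)
  then have "L \<le> n"
    using assms(1)[OF 2(3)] assms(2) by (metis agree_def not_le)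
  then have "agree (n - L) (shift L x) (shift L y)" "L + (n - L) = n" "k - L - (n - L) = k - n"
    using 2(2) by (auto simp: agree_def shift_def)
  then show ?thesis
    using survives_adjacent[OF _ 2(3), of "n - L" "shift L x" "shift L y" "k - L"] 2(4,5) by simp
qed

section \<open>Block rewriting\<close>

locale block_words =
  fixes \<alpha> \<gamma> \<tau> \<kappa> :: 'a
  assumes tau_gamma: "\<tau> \<noteq> \<gamma>" and kappa_gamma: "\<kappa> \<noteq> \<gamma>"
    and alpha_gamma: "\<alpha> \<noteq> \<gamma>" and kappa_alpha: "\<kappa> \<noteq> \<alpha>"
    and kappa_tau: "\<kappa> \<noteq> \<tau>"
begin

lemmas letters = tau_gamma kappa_gamma alpha_gamma kappa_alpha kappa_tau kappa_tau[symmetric]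
  tau_gamma[symmetric] kappa_gamma[symmetric] alpha_gamma[symmetric] kappa_alpha[symmetric]

definition pat :: "nat \<Rightarrow> nat \<Rightarrow> 'a" where
  "pat j n = (if j = 0 then (if n = 0 then \<tau> else \<gamma>)
     else if n = 0 then \<kappa> else if n \<le> j then \<alpha> else if n = Suc j then \<kappa> else \<gamma>)"

text \<open>The block \<open>\<tau>\<gamma>\<gamma>\<close> of length 3 is fixed by all rewritings below; admitting it makes the bound
  \<open>j + 3\<close> on the length uniform in \<open>j\<close>.\<close>

definition blk :: "(nat \<Rightarrow> 'a) \<Rightarrow> nat \<Rightarrow> enat \<Rightarrow> bool" where
  "blk x j L \<longleftrightarrow> (\<forall>l. enat l < L \<longrightarrow> x l = pat j l) \<and> (\<forall>l. L = enat l \<longrightarrow> x l \<noteq> \<gamma>) \<and> enat (j + 3) \<le> L"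

definition has_blk :: "(nat \<Rightarrow> 'a) \<Rightarrow> bool" where
  "has_blk x \<longleftrightarrow> (\<exists>j L. blk x j L)"

lemma pat_late: "j + 3 \<le> l \<Longrightarrow> pat j l = \<gamma>"
  by (simp add: pat_def)

lemma pat_01: "(pat j 0, pat j 1) \<in> {(\<tau>, \<gamma>), (\<kappa>, \<alpha>)}"
  by (simp add: pat_def)

lemma blk_nth: "blk x j L \<Longrightarrow> enat l < L \<Longrightarrow> x l = pat j l"
  by (simp add: blk_def)

lemma blk_early: "blk x j L \<Longrightarrow> l < j + 3 \<Longrightarrow> x l = pat j l"
  unfolding blk_def by (meson enat_ord_simps(2) order_less_le_trans)

text \<open>The index is visible in the word: an initial run of alpha after kappa must end in the
  second kappa at position \<open>Suc i\<close>, where a larger index still demands alpha.\<close>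

lemma blk_index_le:
  assumes "blk x j L" "blk x i K" shows "j \<le> i"
proof (rule ccontr)
  assume "\<not> j \<le> i"
  then have "pat j 1 = pat i 1" "pat j (Suc i) = pat i (Suc i)"
    using blk_early[OF assms(1), of 1] blk_early[OF assms(2), of 1]
      blk_early[OF assms(1), of "Suc i"] blk_early[OF assms(2), of "Suc i"] by auto
  with \<open>\<not> j \<le> i\<close> show False
    using letters by (auto simp: pat_def split: if_splits)
qed

lemma blk_length_le:
  assumes "blk x j L" "blk x j K" shows "L \<le> K"
proof (rule ccontr)
  assume less: "\<not> L \<le> K"
  then obtain l where l: "K = enat l" by (cases K) auto
  then have "x l \<noteq> \<gamma>" "j + 3 \<le> l" using assms(2) by (auto simp: blk_def)
  moreover have "x l = pat j l" using less l assms(1) by (auto simp: blk_def)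
  ultimately show False using pat_late by simp
qed

lemma blk_unique: "blk x j L \<Longrightarrow> blk x i K \<Longrightarrow> j = i \<and> L = K"
  by (metis antisym blk_index_le blk_length_le)

lemma blk_exists:
  assumes "agree m x (pat j)" "j + 3 \<le> m"
  obtains L where "blk x j L" "enat m \<le> L"
proof (cases "\<exists>l\<ge>m. x l \<noteq> \<gamma>")
  case True
  define l where "l = (LEAST l. m \<le> l \<and> x l \<noteq> \<gamma>)"
  have l: "m \<le> l" "x l \<noteq> \<gamma>" using LeastI_ex[OF True] by (auto simp: l_def)
  have "x i = pat j i" if "i < l" for i
    using that not_less_Least[of i "\<lambda>l. m \<le> l \<and> x l \<noteq> \<gamma>"] assms pat_late[of j i]
    by (cases "i < m") (auto simp: l_def agree_def)
  then have "blk x j (enat l)" using l assms by (auto simp: blk_def)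
  then show ?thesis using l that by simp
next
  case False
  then have "x i = pat j i" for i
    using assms pat_late[of j i] by (cases "i < m") (auto simp: agree_def)
  then have "blk x j \<infinity>" by (simp add: blk_def)
  then show ?thesis using that by simp
qed

section \<open>Parsing a word into blocks and single letters\<close>

definition blk_len :: "(nat \<Rightarrow> 'a) \<Rightarrow> enat" where
  "blk_len x = (if has_blk x then THE L. \<exists>j. blk x j L else 1)"

definition blk_ix :: "(nat \<Rightarrow> 'a) \<Rightarrow> nat" where
  "blk_ix x = (THE j. \<exists>L. blk x j L)"

lemma blk_len_eq: "blk x j L \<Longrightarrow> blk_len x = L"
  unfolding blk_len_def has_blk_def using blk_unique by (auto intro!: the_equality)

lemma blk_ix_eq: "blk x j L \<Longrightarrow> blk_ix x = j"
  unfolding blk_ix_def using blk_unique by (auto intro!: the_equality)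

lemma blk_len_pos: "1 \<le> blk_len x"
proof (cases "has_blk x")
  case True
  then obtain j L where b: "blk x j L" by (auto simp: has_blk_def)
  then have "enat 1 \<le> enat (j + 3)" "enat (j + 3) \<le> L" by (auto simp: blk_def)
  then show ?thesis using blk_len_eq[OF b] by (metis one_enat_def order_trans)
qed (simp add: blk_len_def)

text \<open>Greedy parse from the left. The value 1 of \<open>blk_len\<close> off blocks makes a
  letter outside all blocks a piece of length 1 that is copied. An infinite block is never left, so
  \<open>the_enat\<close> is applied to finite lengths only.\<close>

function rewrite :: "(nat \<Rightarrow> enat \<Rightarrow> nat \<Rightarrow> 'a) \<Rightarrow> (nat \<Rightarrow> 'a) \<Rightarrow> nat \<Rightarrow> 'a" where
  "rewrite out x n =
    (if enat n < blk_len x then (if has_blk x then out (blk_ix x) (blk_len x) n else x n)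
     else rewrite out (shift (the_enat (blk_len x)) x) (n - the_enat (blk_len x)))"
  by auto
termination
proof (relation "measure (\<lambda>(out, x, n). n)")
  fix out :: "nat \<Rightarrow> enat \<Rightarrow> nat \<Rightarrow> 'a" and x :: "nat \<Rightarrow> 'a" and n
  assume "\<not> enat n < blk_len x"
  then obtain l where "blk_len x = enat l" "l \<le> n" by (cases "blk_len x") auto
  moreover have "1 \<le> l" using blk_len_pos[of x] calculation by (simp add: one_enat_def)
  ultimately show "((out, shift (the_enat (blk_len x)) x, n - the_enat (blk_len x)), (out, x, n))
      \<in> measure (\<lambda>(out, x, n). n)" by simp
qed simp

declare rewrite.simps [simp del]

lemma rewrite_blk: "blk x j L \<Longrightarrow> enat n < L \<Longrightarrow> rewrite out x n = out j L n"
  by (subst rewrite.simps) (auto simp: blk_len_eq blk_ix_eq has_blk_def)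

lemma shift_rewrite_blk:
  assumes "blk x j (enat l)"
  shows "shift l (rewrite out x) = rewrite out (shift l x)"
proof
  fix n
  show "shift l (rewrite out x) n = rewrite out (shift l x) n"
    unfolding shift_nth[of _ "rewrite out x"]
    by (subst rewrite.simps) (use blk_len_eq[OF assms] in \<open>simp add: shift_def\<close>)
qed

lemma rewrite_plain_0: "\<not> has_blk x \<Longrightarrow> rewrite out x 0 = x 0"
  by (subst rewrite.simps) (simp add: blk_len_def zero_enat_def[symmetric])

lemma shift_rewrite_plain:
  assumes "\<not> has_blk x"
  shows "shift 1 (rewrite out x) = rewrite out (shift 1 x)"
proof
  fix n
  show "shift 1 (rewrite out x) n = rewrite out (shift 1 x) n"
    unfolding shift_nth[of _ "rewrite out x"]
    by (subst rewrite.simps) (use assms in \<open>simp add: blk_len_def one_enat_def shift_def\<close>)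
qed

lemma rewrite_plain_Suc:
  "\<not> has_blk x \<Longrightarrow> rewrite out x (Suc n) = rewrite out (shift 1 x) n"
  using shift_rewrite_plain[of x out] by (metis plus_1_eq_Suc shift_nth)

lemma rewrite_in:
  assumes "\<And>j L n. out j L n \<in> A" "\<And>n. x n \<in> A"
  shows "rewrite out x n \<in> A"
  using assms
  by (induction out x n rule: rewrite.induct) (subst rewrite.simps, auto simp: shift_nth)

lemma blk_start:
  "has_blk x \<Longrightarrow> (x 0, x 1) \<in> {(\<tau>, \<gamma>), (\<kappa>, \<alpha>)}"
  unfolding has_blk_def using pat_01 by (metis blk_early add_pos_pos less_add_same_cancel2
      numeral_less_iff trans_less_add2 zero_less_numeral one_less_numeral_iff semiring_norm(77))

lemma not_has_blk_const: "agree 2 x (corner (v, v)) \<Longrightarrow> \<not> has_blk x"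
  using blk_start[of x] letters by (auto simp: agree_def corner_def numeral_2_eq_2 less_Suc_eq)

text \<open>Two equal letters cannot open a block, so all letters but the last are copied; the last
  one may open a block together with what follows, hence the loss of one.\<close>

lemma rewrite_const:
  "agree n x (corner (v, v)) \<Longrightarrow> agree (n - 1) (rewrite out x) (corner (v, v))"
proof (induction n arbitrary: x)
  case (Suc n)
  show ?case
  proof (cases n)
    case (Suc m)
    have sh: "shift 1 (corner (v, v)) = corner (v, v)" by (auto simp: shift_def corner_def)
    have nb: "\<not> has_blk x"
      using Suc Suc.prems by (intro not_has_blk_const) (auto elim: agree_mono)
    have "agree n (shift 1 x) (corner (v, v))"
      using Suc.prems sh by (simp add: agree_Suc)
    then have "agree (n - 1) (rewrite out (shift 1 x)) (corner (v, v))" by (rule Suc.IH)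
    then show ?thesis
      using Suc Suc.prems nb sh
      by (simp add: agree_Suc rewrite_plain_0 shift_rewrite_plain[simplified])
  qed simp
qed simp

lemma rewrite_corner:
  assumes "agree k x (corner a)" "\<not> has_blk x"
  shows "agree (k - 1) (rewrite out x) (corner a)"
proof (cases k)
  case (Suc m)
  have sh: "shift 1 (corner a) = corner (snd a, snd a)" by (auto simp: shift_def corner_def)
  have "agree (m - 1) (rewrite out (shift 1 x)) (corner (snd a, snd a))"
    using assms Suc sh by (intro rewrite_const) (simp add: agree_Suc)
  then show ?thesis
    using assms Suc sh
    by (cases m) (simp_all add: agree_Suc rewrite_plain_0 shift_rewrite_plain[simplified])
qed simp

section \<open>Recovering the blocks from the rewritten word\<close>

definition good_out :: "(nat \<Rightarrow> enat \<Rightarrow> nat \<Rightarrow> 'a) \<Rightarrow> bool" where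
  "good_out out \<longleftrightarrow> (\<forall>j L. (out j L 0, out j L 1) \<in> {(\<tau>, \<gamma>), (\<kappa>, \<alpha>)})"

lemma rewrite_start:
  assumes "good_out out" "has_blk x"
  shows "(rewrite out x 0, rewrite out x 1) \<in> {(\<tau>, \<gamma>), (\<kappa>, \<alpha>)}"
proof -
  obtain j L where b: "blk x j L" using assms(2) by (auto simp: has_blk_def)
  have "enat (j + 3) \<le> L" using b by (simp add: blk_def)
  then have "enat 0 < L" "enat 1 < L"
    by (meson enat_ord_simps(2) order_less_le_trans add_pos_pos trans_less_add2
        one_less_numeral_iff semiring_norm(77) zero_less_numeral)+
  then have "rewrite out x 0 = out j L 0" "rewrite out x 1 = out j L 1"
    using rewrite_blk[OF b] by auto
  then show ?thesis using assms(1) by (simp add: good_out_def)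
qed

text \<open>No output block begins with gamma, so a leading gamma of the result was copied from a
  single letter; this is repeated along the run.\<close>

lemma rewrite_gammas:
  "good_out out \<Longrightarrow> \<forall>l<n. rewrite out x l = \<gamma> \<Longrightarrow> \<forall>l<n. x l = \<gamma>"
proof (induction n arbitrary: x)
  case (Suc n)
  have nb: "\<not> has_blk x"
    using rewrite_start[OF Suc.prems(1), of x] Suc.prems(2) letters by auto
  have "rewrite out (shift 1 x) l = \<gamma>" if "l < n" for l
    using Suc.prems(2) that rewrite_plain_Suc[OF nb, of out l] by auto
  then have "\<forall>l<n. shift 1 x l = \<gamma>"
    using Suc.prems(1) Suc.IH by blast
  then show ?case
    using Suc.prems(2) rewrite_plain_0[OF nb, of out] by (auto simp: shift_def less_Suc_eq_0_disj)
qed simp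

lemma rewrite_gamma_0:
  assumes "good_out out" shows "rewrite out x 0 = \<gamma> \<longleftrightarrow> x 0 = \<gamma>"
proof
  assume "rewrite out x 0 = \<gamma>"
  then show "x 0 = \<gamma>" using rewrite_gammas[OF assms, of 1 x] by simp
next
  assume "x 0 = \<gamma>"
  then have "\<not> has_blk x" using blk_start[of x] letters by auto
  then show "rewrite out x 0 = \<gamma>" using rewrite_plain_0 \<open>x 0 = \<gamma>\<close> by simp
qed

text \<open>The same for the interior alpha^i kappa gamma of a block: none of its letters can be the
  start of an output block, because the letter pairs tau gamma and kappa alpha do not occur in
  it.\<close>

lemma rewrite_alphas:
  assumes "good_out out"
  shows "\<forall>l<i. rewrite out x l = \<alpha> \<Longrightarrow> rewrite out x i = \<kappa> \<Longrightarrow> rewrite out x (Suc i) = \<gamma> \<Longrightarrow>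
    (\<forall>l<i. x l = \<alpha>) \<and> x i = \<kappa> \<and> x (Suc i) = \<gamma>"
proof (induction i arbitrary: x)
  case 0
  have nb: "\<not> has_blk x"
  proof
    assume "has_blk x"
    then show False using rewrite_start[OF assms] 0(2,3) letters by force
  qed
  have "rewrite out (shift 1 x) 0 = \<gamma>" using 0(3) rewrite_plain_Suc[OF nb, of out 0] by simp
  then have "shift 1 x 0 = \<gamma>" using rewrite_gamma_0[OF assms] by simp
  then show ?case using 0(2) rewrite_plain_0[OF nb, of out] by (simp add: shift_def)
next
  case (Suc i)
  have x0: "rewrite out x 0 = \<alpha>" using Suc.prems(1) by simp
  \<comment> \<open>For tau = alpha the letter at 0 alone does not exclude an output starting with
    tau gamma; the next letter does, since it differs from gamma.\<close>
  have x1: "rewrite out x 1 \<in> {\<alpha>, \<kappa>}" using Suc.prems(1,2) by (cases "i = 0") simp_all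
  have nb: "\<not> has_blk x"
  proof
    assume "has_blk x"
    then show False using rewrite_start[OF assms] x0 x1 letters by force
  qed
  have s: "rewrite out (shift 1 x) l = rewrite out x (Suc l)" for l
    using rewrite_plain_Suc[OF nb, of out l] by simp
  have "(\<forall>l<i. shift 1 x l = \<alpha>) \<and> shift 1 x i = \<kappa> \<and> shift 1 x (Suc i) = \<gamma>"
    by (rule Suc.IH) (simp_all only: s, simp_all add: Suc.prems)
  moreover have "x 0 = \<alpha>" using x0 rewrite_plain_0[OF nb, of out] by simp
  ultimately show ?case by (auto simp: shift_def less_Suc_eq_0_disj)
qed

text \<open>Were there a block in the result but none in \<open>x\<close>, the first letter would be
  copied, and the rest of the pattern, a run of gamma or alpha^j kappa gamma, could only come from
  the same letters of \<open>x\<close>. So \<open>x\<close> would have the block already.\<close>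

lemma has_blk_rewriteD:
  assumes "good_out out" "has_blk (rewrite out x)"
  shows "has_blk x"
proof (rule ccontr)
  assume nb: "\<not> has_blk x"
  obtain j L where b: "blk (rewrite out x) j L" using assms(2) by (auto simp: has_blk_def)
  have e: "rewrite out x l = pat j l" if "l < j + 3" for l using blk_early[OF b that] .
  have x0: "x 0 = pat j 0" using e[of 0] rewrite_plain_0[OF nb] by simp
  have s: "rewrite out (shift 1 x) l = pat j (Suc l)" if "l < j + 2" for l
    using e[of "Suc l"] that rewrite_plain_Suc[OF nb] by simp
  have "shift 1 x l = pat j (Suc l)" if "l < j + 2" for l
  proof (cases "j = 0")
    case True
    have "\<forall>l<2. rewrite out (shift 1 x) l = \<gamma>"
      using True by (auto simp only: s) (simp add: pat_def)
    then have "shift 1 x l = \<gamma>" using rewrite_gammas[OF assms(1), of 2] that True by simp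
    then show ?thesis using True by (simp add: pat_def)
  next
    case False
    have "(\<forall>l<j. shift 1 x l = \<alpha>) \<and> shift 1 x j = \<kappa> \<and> shift 1 x (Suc j) = \<gamma>"
      using False by (intro rewrite_alphas[OF assms(1)] allI impI) (auto simp: s[simplified] pat_def)
    then show ?thesis using that False by (auto simp: pat_def less_Suc_eq)
  qed
  then have "agree (j + 3) x (pat j)"
    using x0 by (auto simp: agree_def shift_def less_Suc_eq_0_disj numeral_3_eq_3 numeral_2_eq_2)
  then show False using nb blk_exists[of "j + 3" x j] by (auto simp: has_blk_def)
qed

text \<open>The block stays maximal: the rest of the word is rewritten separately, and rewriting
  neither creates nor removes a leading gamma.\<close>

lemma blk_rewrite:
  assumes "good_out out" "blk x j L" "out j L = pat i" "enat (i + 3) \<le> L"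
  shows "blk (rewrite out x) i L"
proof -
  have "rewrite out x l \<noteq> \<gamma>" if "L = enat l" for l
    using shift_rewrite_blk[of x j l out] assms(1,2) that rewrite_gamma_0[of out "shift l x"]
    by (metis add_0_right blk_def shift_nth)
  then show ?thesis
    using assms rewrite_blk[OF assms(2)] by (auto simp: blk_def)
qed

text \<open>Both parses cut the word at the same places, so it suffices to invert block by block.
  The second alternative of \<open>step\<close> allows for an infinite block that returns only up to
  gluing; \<open>R\<close> empty gives equality of words.\<close>

lemma rewrite_inverse:
  assumes "good_out out" "good_out out'"
    and step: "\<And>j L. enat (j + 3) \<le> L \<Longrightarrow>
      (\<exists>i. out j L = pat i \<and> enat (i + 3) \<le> L \<and> out' i L = pat j) \<or>
      L = \<infinity> \<and> (\<forall>k. survives R k (rewrite out' (out j L)) (pat j))"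
  shows "survives R k (rewrite out' (rewrite out x)) x"
proof (induction k arbitrary: x rule: less_induct)
  case (less k)
  show ?case
  proof (cases "has_blk x")
    case True
    then obtain j L where b: "blk x j L" by (auto simp: has_blk_def)
    then have jL: "enat (j + 3) \<le> L" by (simp add: blk_def)
    show ?thesis
    proof (cases "\<exists>i. out j L = pat i \<and> enat (i + 3) \<le> L \<and> out' i L = pat j")
      case True
      then obtain i where i: "out j L = pat i" "enat (i + 3) \<le> L" "out' i L = pat j" by blast
      have b': "blk (rewrite out x) i L" using blk_rewrite[OF assms(1) b i(1,2)] .
      have e: "rewrite out' (rewrite out x) l = x l" if "enat l < L" for l
        using rewrite_blk[OF b' that, of out'] i(3) blk_nth[OF b that] by simp
      show ?thesis
      proof (cases L)
        case (enat m)
        have "shift m (rewrite out' (rewrite out x)) = rewrite out' (rewrite out (shift m x))"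
          using shift_rewrite_blk[OF b[unfolded enat]] shift_rewrite_blk[OF b'[unfolded enat]] by simp
        moreover have "survives R (k - m) (rewrite out' (rewrite out (shift m x))) (shift m x)"
          using less[of "k - m"] jL enat by (cases "k = 0") auto
        ultimately show ?thesis
          using e enat by (simp add: survives_prepend[of m] agree_def)
      qed (use e in \<open>auto intro: survives_agree simp: agree_def\<close>)
    next
      case False
      then have L: "L = \<infinity>" "survives R k (rewrite out' (out j L)) (pat j)" using step[OF jL] by auto
      have "rewrite out x = out j L" "x = pat j"
        using rewrite_blk[OF b] blk_nth[OF b] L(1) by auto
      then show ?thesis using L(2) by simp
    qed
  next
    case False
    then have nb: "\<not> has_blk (rewrite out x)" using has_blk_rewriteD assms(1) by blast
    have "shift 1 (rewrite out' (rewrite out x)) = rewrite out' (rewrite out (shift 1 x))"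
      unfolding shift_rewrite_plain[OF False, symmetric] shift_rewrite_plain[OF nb] ..
    moreover have "survives R (k - 1) (rewrite out' (rewrite out (shift 1 x))) (shift 1 x)"
      using less[of "k - 1"] by (cases "k = 0") auto
    ultimately show ?thesis
      using rewrite_plain_0[OF False, of out] rewrite_plain_0[OF nb, of out']
      by (metis survives_prepend agree_def less_one)
  qed
qed

section \<open>Bounded loss of surviving time under rewriting\<close>

definition near :: "('a \<times> 'a) set \<Rightarrow> nat \<Rightarrow> (nat \<Rightarrow> 'a) \<Rightarrow> bool" where
  "near N k x \<longleftrightarrow> (\<exists>a\<in>N. agree k x (corner a))"

lemma near_mono: "near N k x \<Longrightarrow> m \<le> k \<Longrightarrow> near N m x"
  unfolding near_def by (meson agree_mono)

lemma near_cong: "near N k x \<Longrightarrow> agree k x y \<Longrightarrow> near N k y"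
  unfolding near_def by (meson agree_sym agree_trans)

lemma pat_0: "pat 0 = corner (\<tau>, \<gamma>)"
  by (auto simp: pat_def corner_def)

lemma pat_near: "0 < j \<Longrightarrow> agree (Suc j) (pat j) (corner (\<kappa>, \<alpha>))"
  by (auto simp: agree_def pat_def corner_def)

end

text \<open>\<open>R\<close> and \<open>R'\<close> are the gluings before and after rewriting.  In each of them the corner
  \<open>(\<tau>, \<gamma>)\<close> is either glued to \<open>(\<kappa>, \<alpha>)\<close> or free; \<open>N\<close> and \<open>N'\<close> are the classes of
  \<open>(\<kappa>, \<alpha>)\<close> among these two corners.\<close>

locale block_rewriting = block_words +
  fixes R R' :: "(('a \<times> 'a) \<times> ('a \<times> 'a)) set" and N N' :: "('a \<times> 'a) set"
    and out :: "nat \<Rightarrow> enat \<Rightarrow> nat \<Rightarrow> 'a"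
  assumes sym_R: "sym R" and sym_R': "sym R'"
    and irrefl_R: "(a, b) \<in> R \<Longrightarrow> fst a \<noteq> fst b"
    and alpha_free: "((\<alpha>, \<alpha>), b) \<notin> R"
    and gamma_free: "((\<gamma>, v), b) \<notin> R"
    and kappa_free: "((\<kappa>, \<gamma>), b) \<notin> R"
    and N: "(\<kappa>, \<alpha>) \<in> N" "N \<subseteq> {(\<kappa>, \<alpha>), (\<tau>, \<gamma>)}"
    and N': "(\<kappa>, \<alpha>) \<in> N'" "\<And>a b. a \<in> N' \<Longrightarrow> b \<in> N' \<Longrightarrow> a \<noteq> b \<Longrightarrow> (a, b) \<in> R'"
    and plain: "(a, b) \<in> R \<Longrightarrow> a \<notin> {(\<kappa>, \<alpha>), (\<tau>, \<gamma>)} \<Longrightarrow> b \<notin> {(\<kappa>, \<alpha>), (\<tau>, \<gamma>)} \<Longrightarrow> (a, b) \<in> R'"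
    and special: "(a, b) \<in> R \<Longrightarrow> a \<in> {(\<kappa>, \<alpha>), (\<tau>, \<gamma>)} \<Longrightarrow>
      a \<in> N \<and> (b \<in> N \<or> b \<notin> {(\<kappa>, \<alpha>), (\<tau>, \<gamma>)} \<and> (\<forall>c\<in>N'. (c, b) \<in> R'))"
    and out_near: "0 < j \<Longrightarrow> enat (j + 3) \<le> L \<Longrightarrow> near N' (j - 1) (out j L)"
    and out_near_0: "(\<tau>, \<gamma>) \<in> N \<Longrightarrow> enat (m + 3) \<le> L \<Longrightarrow> near N' m (out 0 L)"
    and out_local: "j + 3 < m \<Longrightarrow> enat m \<le> L \<Longrightarrow> enat m \<le> K \<Longrightarrow>
      agree m (out j L) (out j K) \<or> j = 0 \<and> (\<tau>, \<gamma>) \<in> N"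
begin

lemma near_rewrite:
  assumes "near N k x" shows "near N' (k - 3) (rewrite out x)"
proof (cases "k \<le> 3")
  case True
  then show ?thesis using N'(1) by (auto simp: near_def)
next
  case False
  obtain a where a: "a \<in> N" "agree k x (corner a)" using assms by (auto simp: near_def)
  consider "a = (\<kappa>, \<alpha>)" | "a = (\<tau>, \<gamma>)" using a N by auto
  then show ?thesis
  proof cases
    case 1
    show ?thesis
    proof (cases "has_blk x")
      case True
      then obtain j L where b: "blk x j L" by (auto simp: has_blk_def)
      then have L: "enat (j + 3) \<le> L" by (simp add: blk_def)
      have x1: "x l = \<alpha>" if "0 < l" "l < k" for l
        using a(2) 1 that by (auto simp: agree_def corner_def)
      have j: "0 < j"
        using x1[of 1] blk_early[OF b, of 1] False letters by (cases j) (auto simp: pat_def)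
      have "x (Suc j) = \<kappa>" using blk_early[OF b, of "Suc j"] j by (simp add: pat_def)
      \<comment> \<open>The second kappa, at position \<open>Suc j\<close>, ends the resemblance
        with kappa alpha^inf, so closeness \<open>k\<close> forces a large index and
        \<open>out_near\<close> applies.\<close>
      then have "k \<le> Suc j" using x1[of "Suc j"] letters by force
      moreover have "agree (j - 1) (out j L) (rewrite out x)"
        unfolding agree_def
      proof (intro allI impI)
        fix l assume "l < j - 1"
        then have "enat l < enat (j + 3)" by simp
        then show "out j L l = rewrite out x l"
          using rewrite_blk[OF b] L by (metis order_less_le_trans)
      qed
      ultimately show ?thesis
        using near_mono[OF near_cong[OF out_near[OF j L]], of "rewrite out x" "k - 3"] by simp
    next
      case False
      then have "agree (k - 1) (rewrite out x) (corner (\<kappa>, \<alpha>))"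
        using rewrite_corner a 1 by blast
      then have "agree (k - 3) (rewrite out x) (corner (\<kappa>, \<alpha>))" by (rule agree_mono) simp
      then show ?thesis using N'(1) by (auto simp: near_def)
    qed
  next
    case 2
    then have "agree k x (pat 0)" using a(2) pat_0 by simp
    then obtain L where b: "blk x 0 L" "enat k \<le> L" using blk_exists[of k x 0] False by auto
    \<comment> \<open>The 3 comes from the cycle: in length \<open>L\<close> the largest index is
      \<open>L - 3\<close>, so a long tau gamma^(L-1) can be sent only that close to kappa
      alpha^inf.\<close>
    have "near N' (k - 3) (out 0 L)"
      using 2 a(1) b(2) False by (intro out_near_0) auto
    moreover have "agree (k - 3) (out 0 L) (rewrite out x)"
      unfolding agree_def
    proof (intro allI impI)
      fix l assume "l < k - 3"
      then have "enat l < enat k" by simp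
      then show "out 0 L l = rewrite out x l"
        using rewrite_blk[OF b(1)] b(2) by (metis order_less_le_trans)
    qed
    ultimately show ?thesis by (rule near_cong)
  qed
qed

lemma corner_survives:
  assumes "(a, b) \<in> R'" "agree k x (corner a)" "agree k y (corner b)"
  shows "survives R' k x y"
  using assms survives_adjacent[of 0 x y a b R' k] by simp

lemma near_survives:
  assumes "near N' k x" "near N' k y" shows "survives R' k x y"
proof -
  obtain a b where ab: "a \<in> N'" "b \<in> N'" "agree k x (corner a)" "agree k y (corner b)"
    using assms by (auto simp: near_def)
  show ?thesis
  proof (cases "a = b")
    case True
    then have "agree k x y" using agree_trans[OF ab(3)] agree_sym[OF ab(4)] by simp
    then show ?thesis by (rule survives_agree)
  next
    case False
    then show ?thesis using corner_survives[OF N'(2)] ab by blast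
  qed
qed

lemma rewrite_plain_corner:
  assumes "agree k x (corner a)" "a \<notin> {(\<kappa>, \<alpha>), (\<tau>, \<gamma>)}"
  shows "agree (k - 3) (rewrite out x) (corner a)"
proof (cases "k \<le> 3")
  case False
  then have "x 0 = fst a" "x 1 = snd a" using assms(1) by (auto simp: agree_def)
  then have "\<not> has_blk x" using blk_start[of x] assms(2) by (cases a) auto
  then show ?thesis by (intro agree_mono[OF rewrite_corner[OF assms(1)]]) auto
qed simp

lemma special_survives:
  assumes "(a, b) \<in> R" "a \<in> {(\<kappa>, \<alpha>), (\<tau>, \<gamma>)}" "agree k x (corner a)" "agree k y (corner b)"
  shows "survives R' (k - 3) (rewrite out x) (rewrite out y)"
proof -
  have "a \<in> N" using special assms by blast
  then have x: "near N' (k - 3) (rewrite out x)" using near_rewrite assms(3) by (auto simp: near_def)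
  show ?thesis
  proof (cases "b \<in> N")
    case True
    then have "near N' (k - 3) (rewrite out y)" using near_rewrite assms(4) by (auto simp: near_def)
    then show ?thesis using x near_survives by blast
  next
    case False
    then have b: "b \<notin> {(\<kappa>, \<alpha>), (\<tau>, \<gamma>)}" "\<forall>c\<in>N'. (c, b) \<in> R'" using special assms by blast+
    obtain c where "c \<in> N'" "agree (k - 3) (rewrite out x) (corner c)" using x by (auto simp: near_def)
    then show ?thesis using b rewrite_plain_corner[OF assms(4)] corner_survives by blast
  qed
qed

lemma adjacent_survives:
  assumes "(a, b) \<in> R" "agree k x (corner a)" "agree k y (corner b)"
  shows "survives R' (k - 3) (rewrite out x) (rewrite out y)"
proof (cases "a \<in> {(\<kappa>, \<alpha>), (\<tau>, \<gamma>)} \<or> b \<in> {(\<kappa>, \<alpha>), (\<tau>, \<gamma>)}")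
  case True
  then show ?thesis
    using special_survives assms sym_R sym_R' by (meson survives_sym symD)
next
  case False
  then have "(a, b) \<in> R'" using plain assms(1) by blast
  moreover have "agree (k - 3) (rewrite out x) (corner a)" "agree (k - 3) (rewrite out y) (corner b)"
    using rewrite_plain_corner assms False by auto
  ultimately show ?thesis by (rule corner_survives)
qed

lemma gamma_free': "(b, (\<gamma>, v)) \<notin> R"
  using gamma_free[of v b] symD[OF sym_R, of b "(\<gamma>, v)"] by blast

text \<open>Blocks are insulated. Words that part inside one and follow glued corners for at least
  three letters would branch at a gamma, at \<open>(\<alpha>, \<alpha>)\<close> or at
  \<open>(\<kappa>, \<gamma>)\<close>, all free, or at position \<open>j\<close>, where kappa gamma
  follows instead of a constant tail. Two letters are lost because the constancy of a tail shows
  only in its second letter.\<close>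

lemma blk_agree:
  assumes "survives R k x y" "x 0 = y 0" "blk x j L" "\<not> blk y j L"
  shows "agree (k - 2) x y"
proof -
  have "\<exists>n\<ge>k - 2. agree n x y"
    using assms(1)
  proof (cases rule: survives_cases)
    case (2 n a b)
    note n = 2(2) and ab = 2(3-5)
    have "k - 2 \<le> n"
    proof (rule ccontr)
      assume k: "\<not> k - 2 \<le> n"
      have x: "x n = fst a" "x (Suc n) = snd a" "x (Suc (Suc n)) = snd a" and y: "y n = fst b"
        using ab(2,3)[unfolded agree_def shift_def corner_def, rule_format, of 0]
          ab(2)[unfolded agree_def shift_def corner_def, rule_format, of 1]
          ab(2)[unfolded agree_def shift_def corner_def, rule_format, of 2] k by auto
      have "fst a \<noteq> \<gamma>" "fst b \<noteq> \<gamma>"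
        using ab(1) gamma_free[of "snd a" b] gamma_free'[of a "snd b"] by (cases a; cases b; auto)+
      have n0: "0 < n" using x(1) y assms(2) irrefl_R[OF ab(1)] by (metis gr0I)
      \<comment> \<open>Parting at or behind the end of the block would give \<open>y\<close> the
        same block: its terminating letter is either common to both words or equal to
        \<open>fst b\<close>, which is not gamma.\<close>
      have nL: "enat n < L"
      proof (rule ccontr)
        assume "\<not> enat n < L"
        then obtain l where l: "L = enat l" "l \<le> n" by (cases L) auto
        have "y l \<noteq> \<gamma>"
          using l assms(3) n y \<open>fst b \<noteq> \<gamma>\<close> by (cases "l = n") (auto simp: blk_def agree_def)
        then have "blk y j L" using assms(3) l n by (auto simp: blk_def agree_def)
        then show False using assms(4) by simp
      qed
      then have "pat j n \<noteq> \<gamma>" using x blk_nth[OF assms(3)] \<open>fst a \<noteq> \<gamma>\<close> by metis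
      then have j: "0 < j" "n \<le> Suc j" using n0 by (auto simp: pat_def split: if_splits)
      note e = blk_early[OF assms(3)]
      consider "n = Suc j" | "n = j" | "n < j" using j by linarith
      then show False
      proof cases
        case 1
        then have "a = (\<kappa>, \<gamma>)" using e[of n] e[of "Suc n"] x j by (auto simp: pat_def prod_eq_iff)
        then show False using ab(1) kappa_free by simp
      next
        case 2
        then show False using e[of "Suc n"] e[of "Suc (Suc n)"] x j letters by (auto simp: pat_def)
      next
        case 3
        then have "a = (\<alpha>, \<alpha>)" using e[of n] e[of "Suc n"] x j n0 by (auto simp: pat_def prod_eq_iff)
        then show False using ab(1) alpha_free by simp
      qed
    qed
    then show ?thesis using n by blast
  qed (meson diff_le_self le_trans)
  then show ?thesis using agree_mono by blast
qed

text \<open>The 7 is 2 + 2 + 3: two letters lost in \<open>blk_agree\<close>, two in passing from a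
  prefix of length at most \<open>j + 3\<close> to the \<open>j + 1\<close> letters that
  \<open>pat j\<close> shares with kappa alpha^inf, and three in
  \<open>near_rewrite\<close>.\<close>

lemma blk_survives:
  assumes "survives R k x y" "x 0 = y 0" "blk x j L" "\<not> blk y j L"
  shows "survives R' (k - 7) (rewrite out x) (rewrite out y)"
proof -
  define m where "m = k - 2"
  have xy: "agree m x y" using blk_agree[OF assms] by (simp add: m_def)
  have mL: "enat m \<le> L"
  proof (rule ccontr)
    assume "\<not> enat m \<le> L"
    then obtain l where l: "L = enat l" "l < m" by (cases L) auto
    then have "blk y j L" using assms(3) xy by (auto simp: blk_def agree_def)
    then show False using assms(4) by simp
  qed
  have x: "agree m x (pat j)"
    unfolding agree_def
  proof (intro allI impI)
    fix l assume "l < m"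
    then have "enat l < L" using mL by (meson enat_ord_simps(2) order_less_le_trans)
    then show "x l = pat j l" using blk_nth[OF assms(3)] by simp
  qed
  have y: "agree m y (pat j)" using x xy agree_sym agree_trans by blast
  show ?thesis
  proof (cases "m \<le> j + 3")
    case True
    show ?thesis
    proof (cases "j = 0")
      case True
      then have "k - 7 = 0" using \<open>m \<le> j + 3\<close> by (simp add: m_def)
      then show ?thesis by simp
    next
      case False
      then have "agree (m - 2) (pat j) (corner (\<kappa>, \<alpha>))"
        using True by (intro agree_mono[OF pat_near]) auto
      then have "agree (m - 2) x (corner (\<kappa>, \<alpha>))" "agree (m - 2) y (corner (\<kappa>, \<alpha>))"
        using x y agree_mono agree_trans by (meson diff_le_self)+
      then have "near N (m - 2) x" "near N (m - 2) y" using N(1) by (auto simp: near_def)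
      then have "survives R' (m - 2 - 3) (rewrite out x) (rewrite out y)"
        by (intro near_survives near_rewrite)
      then show ?thesis by (simp add: m_def)
    qed
  next
    case False
    \<comment> \<open>The common prefix now shows the whole index, so both words have a block of
      index \<open>j\<close> and differ in its length only. Either the outputs do not see the length
      before \<open>m\<close>, or \<open>(\<tau>, \<gamma>)\<close> is glued and both words lie near
      the class \<open>N\<close>.\<close>
    then obtain K where K: "blk y j K" "enat m \<le> K" using blk_exists[OF y] by auto
    consider "agree m (out j L) (out j K)" | "j = 0" "(\<tau>, \<gamma>) \<in> N"
      using out_local[OF _ mL K(2), of j] False by auto
    then show ?thesis
    proof cases
      case 1
      have "agree m (rewrite out x) (rewrite out y)"
        unfolding agree_def
      proof (intro allI impI)
        fix l assume "l < m"
        then have "enat l < L" "enat l < K"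
          using mL K(2) by (meson enat_ord_simps(2) order_less_le_trans)+
        then show "rewrite out x l = rewrite out y l"
          using rewrite_blk assms(3) K(1) 1 \<open>l < m\<close> by (simp add: agree_def)
      qed
      then show ?thesis by (intro survives_agree) (auto simp: m_def elim: agree_mono)
    next
      case 2
      then have "near N m x" "near N m y" using x y pat_0 by (auto simp: near_def)
      then have "survives R' (m - 3) (rewrite out x) (rewrite out y)"
        by (intro near_survives near_rewrite)
      then show ?thesis by (rule survives_mono) (simp add: m_def)
    qed
  qed
qed

text \<open>Common pieces of the two parses are stripped without loss, which is why the 7 does not
  grow in the induction. It is paid once, when the first letters or the first blocks differ.\<close>

lemma rewrite_survives:
  "survives R k x y \<Longrightarrow> survives R' (k - 7) (rewrite out x) (rewrite out y)"
proof (induction k arbitrary: x y rule: less_induct)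
  case (less k)
  show ?case
  proof (cases "x 0 = y 0 \<and> k \<noteq> 0")
    case False
    show ?thesis
      using less.prems
    proof (cases rule: survives_cases)
      case (1 n)
      then have "k = 0" using False by (cases n) (auto simp: agree_def)
      then show ?thesis by simp
    next
      case (2 n a b)
      then have "n = 0" using False by (cases n) (auto simp: agree_def)
      then have "survives R' (k - 3) (rewrite out x) (rewrite out y)"
        using adjacent_survives[OF 2(3)] 2(4,5) by simp
      then show ?thesis by (rule survives_mono) simp
    qed
  next
    case True
    have step: "survives R' (k - 7) (rewrite out x) (rewrite out y)"
      if "0 < l" "agree l x y" "agree l (rewrite out x) (rewrite out y)"
        "shift l (rewrite out x) = rewrite out (shift l x)" "shift l (rewrite out y) = rewrite out (shift l y)" for l
    proof -
      have "survives R (k - l) (shift l x) (shift l y)"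
        using survives_shift irrefl_R that(2) less.prems by blast
      then have "survives R' (k - l - 7) (rewrite out (shift l x)) (rewrite out (shift l y))"
        using less.IH[of "k - l" "shift l x" "shift l y"] that(1) True by simp
      then have "survives R' (k - 7 - l) (shift l (rewrite out x)) (shift l (rewrite out y))"
        using that(4,5) by (metis diff_commute)
      then show ?thesis by (rule survives_prepend[OF that(3)])
    qed
    consider (same) j L where "blk x j L" "blk y j L" | (x) j L where "blk x j L" "\<not> blk y j L"
      | (y) j L where "blk y j L" "\<not> blk x j L" | (none) "\<not> has_blk x" "\<not> has_blk y"
      unfolding has_blk_def by blast
    then show ?thesis
    proof cases
      case same
      have e: "x l = y l" "rewrite out x l = rewrite out y l" if "enat l < L" for l
        using same that by (auto simp: blk_nth rewrite_blk)
      show ?thesis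
      proof (cases L)
        case (enat l)
        then show ?thesis
          using same(1) e shift_rewrite_blk[OF same(1)[unfolded enat], of out]
            shift_rewrite_blk[OF same(2)[unfolded enat], of out]
          by (intro step[of l]) (simp_all add: agree_def blk_def)
      next
        case infinity
        then show ?thesis using e by (auto intro!: survives_agree simp: agree_def)
      qed
    next
      case x
      then show ?thesis using blk_survives less.prems True by blast
    next
      case y
      then show ?thesis
        using survives_sym[OF sym_R' blk_survives[OF survives_sym[OF sym_R less.prems] _ y]] True by simp
    next
      case none
      then show ?thesis
        using True rewrite_plain_0[OF none(1), of out] rewrite_plain_0[OF none(2), of out]
          shift_rewrite_plain[OF none(1), of out] shift_rewrite_plain[OF none(2), of out]
        by (intro step[of 1]) (simp_all add: agree_def)
    qed
  qed
qed

end

section \<open>Detaching a corner\<close>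

lemma survives_all_iff:
  assumes "\<And>a b. (a, b) \<in> R \<Longrightarrow> fst a \<noteq> fst b"
  shows "(\<forall>k. survives R k x y) \<longleftrightarrow> x = y \<or>
    (\<exists>n a b. agree n x y \<and> (a, b) \<in> R \<and> shift n x = corner a \<and> shift n y = corner b)"
    (is "?l \<longleftrightarrow> ?r")
proof
  assume l: ?l
  show ?r
  proof (cases "x = y")
    case False
    then have ex: "\<exists>n. x n \<noteq> y n" by (meson ext)
    define n where "n = (LEAST n. x n \<noteq> y n)"
    have n: "x n \<noteq> y n" using LeastI_ex[OF ex] by (simp add: n_def)
    have "x l = y l" if "l < n" for l
      using not_less_Least[OF that[unfolded n_def]] by blast
    then have "agree n x y" by (simp add: agree_def)
    define a where "a = (x n, x (Suc n))"
    define b where "b = (y n, y (Suc n))"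
    have *: "(a, b) \<in> R \<and> agree k (shift n x) (corner a) \<and> agree k (shift n y) (corner b)" for k
    proof -
      \<comment> \<open>Survival beyond \<open>n + 2\<close> forces the branching to take place at
        \<open>n\<close> and exposes both letters of each corner, so the pair is the same for every
        \<open>k\<close>.\<close>
      have "survives R (n + 2 + k) x y" using l by simp
      then show ?thesis
      proof (cases rule: survives_cases)
        case (1 m)
        then show ?thesis using n by (simp add: agree_def)
      next
        case (2 m a' b')
        have "x m = fst a'" "y m = fst b'"
          using 2(1) 2(4,5)[unfolded agree_def, rule_format, of 0] by (simp_all add: shift_def)
        then have "x m \<noteq> y m" using assms[OF 2(3)] by simp
        then have "n \<le> m" using \<open>agree n x y\<close> by (metis agree_def not_less)
        moreover have "m \<le> n" using n 2(2) by (metis agree_def not_less)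
        ultimately have m: "m = n" by simp
        then have "a' = a" "b' = b"
          using 2(4,5)[unfolded agree_def, rule_format, of 0] 2(4,5)[unfolded agree_def, rule_format, of 1]
          by (simp_all add: shift_def a_def b_def prod_eq_iff)
        moreover have "agree k (shift n x) (corner a)" "agree k (shift n y) (corner b)"
          using agree_mono[OF 2(4), of k] agree_mono[OF 2(5), of k] m \<open>a' = a\<close> \<open>b' = b\<close> by auto
        ultimately show ?thesis using 2(3) by simp
      qed
    qed
    have "shift n x l = corner a l \<and> shift n y l = corner b l" for l
      using *[of "Suc l"] by (simp add: agree_def)
    then have "shift n x = corner a" "shift n y = corner b" by auto
    moreover have "(a, b) \<in> R" using *[of 0] by simp
    ultimately show ?thesis using \<open>agree n x y\<close> by blast
  qed simp
next
  assume ?r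
  then consider "x = y" | n a b where "agree n x y" "(a, b) \<in> R" "shift n x = corner a" "shift n y = corner b"
    by blast
  then show ?l
  proof cases
    case 1
    then show ?thesis using survives_agree[OF agree_refl] by blast
  next
    case 2
    then show ?thesis using survives_adjacent[OF 2(1,2)] by simp
  qed
qed

text \<open>If the two gluings happened at different positions, the later corner of \<open>y\<close>
  would lie in the constant tail of the earlier one and have the form \<open>(v, v)\<close>, which
  is free. So both are at one position and transitivity of \<open>R\<close> applies.\<close>

lemma survives_all_trans:
  assumes irrefl: "\<And>a b. (a, b) \<in> R \<Longrightarrow> fst a \<noteq> fst b" and "sym R"
    and trans: "\<And>a b c. (a, b) \<in> R \<Longrightarrow> (b, c) \<in> R \<Longrightarrow> a \<noteq> c \<Longrightarrow> (a, c) \<in> R"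
    and diag_free: "\<And>v b. ((v, v), b) \<notin> R"
    and xy: "\<forall>k. survives R k x y" and yz: "\<forall>k. survives R k y z"
  shows "survives R k x z"
proof (cases "x = y \<or> y = z")
  case True
  then show ?thesis using xy yz by auto
next
  case False
  obtain n a b where n: "agree n x y" "(a, b) \<in> R" "shift n x = corner a" "shift n y = corner b"
    using xy False survives_all_iff[of R x y] irrefl by blast
  obtain m b' c where m: "agree m y z" "(b', c) \<in> R" "shift m y = corner b'" "shift m z = corner c"
    using yz False survives_all_iff[of R y z] irrefl by blast
  have yn: "y (n + l) = corner b l" for l using n(4) by (metis shift_nth)
  have ym: "y (m + l) = corner b' l" for l using m(3) by (metis shift_nth)
  consider "n < m" | "m < n" | "n = m" by linarith
  then show ?thesis
  proof cases
    case 1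
    then have "b' = (snd b, snd b)"
      using ym[of 0] ym[of 1] yn[of "m - n"] yn[of "m + 1 - n"] by (simp add: prod_eq_iff)
    then show ?thesis using m(2) diag_free by simp
  next
    case 2
    then have "b = (snd b', snd b')"
      using yn[of 0] yn[of 1] ym[of "n - m"] ym[of "n + 1 - m"] by (simp add: prod_eq_iff)
    then show ?thesis using symD[OF \<open>sym R\<close> n(2)] diag_free by metis
  next
    case 3
    have "b' = b" using yn[of 0] yn[of 1] ym[of 0] ym[of 1] 3 by (simp add: prod_eq_iff)
    have xz: "agree n x z" using agree_trans n(1) m(1) 3 by blast
    show ?thesis
    proof (cases "a = c")
      case True
      then have "survives R (k - n) (shift n x) (shift n z)"
        using n(3) m(4) 3 by (simp add: survives_agree)
      then show ?thesis using survives_prepend xz by blast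
    next
      case False
      then have "(a, c) \<in> R" using trans n(2) m(2) \<open>b' = b\<close> by blast
      then show ?thesis using survives_adjacent[OF xz] n(3) m(4) 3 by simp
    qed
  qed
qed

locale detachment = block_words +
  fixes R :: "(('a \<times> 'a) \<times> ('a \<times> 'a)) set"
  assumes sym_R: "sym R"
    and irrefl_R: "(a, b) \<in> R \<Longrightarrow> fst a \<noteq> fst b"
    and trans_R: "(a, b) \<in> R \<Longrightarrow> (b, c) \<in> R \<Longrightarrow> a \<noteq> c \<Longrightarrow> (a, c) \<in> R"
    and diag_free: "((v, v), b) \<notin> R"
    and gamma_free: "((\<gamma>, v), b) \<notin> R"
    and kappa_free: "((\<kappa>, \<gamma>), b) \<notin> R"
    and glued: "((\<tau>, \<gamma>), (\<kappa>, \<alpha>)) \<in> R"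
begin

definition R' :: "(('a \<times> 'a) \<times> ('a \<times> 'a)) set" where
  "R' = {(a, b) \<in> R. a \<noteq> (\<tau>, \<gamma>) \<and> b \<noteq> (\<tau>, \<gamma>)}"

text \<open>The cyclic step toward the glued side. The index \<open>L - 3\<close> is the last that
  fits and returns to 0; in an infinite block this never happens and the step is the shift
  \<open>j\<close> to \<open>j + 1\<close>.\<close>

definition advance :: "nat \<Rightarrow> enat \<Rightarrow> nat \<Rightarrow> 'a" where
  "advance j L = (if enat (j + 3) < L then pat (Suc j) else pat 0)"

text \<open>The inverse of \<open>advance\<close>.  The infinite block \<open>\<tau>\<gamma>\<gamma>\<gamma>\<dots>\<close> is outside the range of
  \<open>advance\<close>; it is sent to the limit \<open>\<kappa>\<alpha>\<alpha>\<alpha>\<dots>\<close> of the images of its finite truncations.\<close>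

definition retreat :: "nat \<Rightarrow> enat \<Rightarrow> nat \<Rightarrow> 'a" where
  "retreat j L = (if 0 < j then pat (j - 1) else
     case L of enat l \<Rightarrow> pat (l - 3) | \<infinity> \<Rightarrow> corner (\<kappa>, \<alpha>))"

lemma good_out_advance: "good_out advance"
  using pat_01 by (simp add: good_out_def advance_def)

lemma good_out_retreat: "good_out retreat"
  using pat_01 by (simp add: good_out_def retreat_def corner_def split: enat.split)

lemma glued': "((\<kappa>, \<alpha>), (\<tau>, \<gamma>)) \<in> R"
  using symD[OF sym_R glued] .

lemma sym_R': "sym R'"
  using sym_R by (auto simp: R'_def sym_def)

lemma near_pat: "0 < j \<Longrightarrow> (\<kappa>, \<alpha>) \<in> N \<Longrightarrow> m \<le> Suc j \<Longrightarrow> near N m (pat j)"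
  unfolding near_def using agree_mono[OF pat_near] by blast

lemma near_pat_0: "(\<tau>, \<gamma>) \<in> N \<Longrightarrow> near N m (pat 0)"
  unfolding near_def pat_0 by (meson agree_refl)

text \<open>From the detached gluing to the original one, hence \<open>R'\<close> in the first
  place. A corner glued to \<open>(\<kappa>, \<alpha>)\<close> is glued to
  \<open>(\<tau>, \<gamma>)\<close> in \<open>R\<close> by transitivity. The output depends on the
  length only when the index wraps, and \<open>j + 3 < m\<close> excludes that.\<close>

sublocale adv: block_rewriting \<alpha> \<gamma> \<tau> \<kappa> R' R "{(\<kappa>, \<alpha>)}" "{(\<kappa>, \<alpha>), (\<tau>, \<gamma>)}" advance
proof
  show "sym R'" "sym R" by (rule sym_R' sym_R)+
  show "fst a \<noteq> fst b" if "(a, b) \<in> R'" for a b using that irrefl_R by (simp add: R'_def)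
  show "((\<alpha>, \<alpha>), b) \<notin> R'" "((\<gamma>, v), b) \<notin> R'" "((\<kappa>, \<gamma>), b) \<notin> R'" for v b
    using diag_free gamma_free kappa_free by (simp_all add: R'_def)
  show "(a, b) \<in> R" if "a \<in> {(\<kappa>, \<alpha>), (\<tau>, \<gamma>)}" "b \<in> {(\<kappa>, \<alpha>), (\<tau>, \<gamma>)}" "a \<noteq> b" for a b
    using that glued glued' by auto
  show "(a, b) \<in> R" if "(a, b) \<in> R'" for a b using that by (simp add: R'_def)
  show "a \<in> {(\<kappa>, \<alpha>)} \<and> (b \<in> {(\<kappa>, \<alpha>)} \<or>
      b \<notin> {(\<kappa>, \<alpha>), (\<tau>, \<gamma>)} \<and> (\<forall>c\<in>{(\<kappa>, \<alpha>), (\<tau>, \<gamma>)}. (c, b) \<in> R))"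
    if "(a, b) \<in> R'" "a \<in> {(\<kappa>, \<alpha>), (\<tau>, \<gamma>)}" for a b
  proof -
    have ab: "(a, b) \<in> R" "a = (\<kappa>, \<alpha>)" "b \<noteq> (\<tau>, \<gamma>)" using that by (auto simp: R'_def)
    then have "b \<noteq> (\<kappa>, \<alpha>)" using irrefl_R by blast
    moreover have "((\<tau>, \<gamma>), b) \<in> R" using trans_R[OF glued] ab by simp
    ultimately show ?thesis using ab by simp
  qed
  show "near {(\<kappa>, \<alpha>), (\<tau>, \<gamma>)} (j - 1) (advance j L)" for j L
    using near_pat[of "Suc j" _ "j - 1"] near_pat_0 by (simp add: advance_def)
  show "near {(\<kappa>, \<alpha>), (\<tau>, \<gamma>)} m (advance 0 L)" if "(\<tau>, \<gamma>) \<in> {(\<kappa>, \<alpha>)}" for m L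
    using that letters by simp
  show "agree m (advance j L) (advance j K) \<or> j = 0 \<and> (\<tau>, \<gamma>) \<in> {(\<kappa>, \<alpha>)}"
    if "j + 3 < m" "enat m \<le> L" "enat m \<le> K" for j m L K
  proof -
    have "enat (j + 3) < L" "enat (j + 3) < K"
      using that by (meson enat_ord_simps(2) order_less_le_trans)+
    then show ?thesis by (simp add: advance_def)
  qed
qed auto

text \<open>Here both corners belong to the class before rewriting and only
  \<open>(\<kappa>, \<alpha>)\<close> after it. A corner glued to \<open>(\<tau>, \<gamma>)\<close>
  stays glued to \<open>(\<kappa>, \<alpha>)\<close>. Only blocks of index 0 have an output
  depending on the length, and these are near the class.\<close>

sublocale ret: block_rewriting \<alpha> \<gamma> \<tau> \<kappa> R R' "{(\<kappa>, \<alpha>), (\<tau>, \<gamma>)}" "{(\<kappa>, \<alpha>)}" retreat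
proof
  show "sym R'" "sym R" by (rule sym_R' sym_R)+
  show "fst a \<noteq> fst b" if "(a, b) \<in> R" for a b using that irrefl_R by simp
  show "((\<alpha>, \<alpha>), b) \<notin> R" "((\<gamma>, v), b) \<notin> R" "((\<kappa>, \<gamma>), b) \<notin> R" for v b
    using diag_free gamma_free kappa_free by simp_all
  show "(a, b) \<in> R'" if "a \<in> {(\<kappa>, \<alpha>)}" "b \<in> {(\<kappa>, \<alpha>)}" "a \<noteq> b" for a b
    using that by simp
  show "(a, b) \<in> R'" if "(a, b) \<in> R" "a \<notin> {(\<kappa>, \<alpha>), (\<tau>, \<gamma>)}" "b \<notin> {(\<kappa>, \<alpha>), (\<tau>, \<gamma>)}" for a b
    using that by (simp add: R'_def)
  show "a \<in> {(\<kappa>, \<alpha>), (\<tau>, \<gamma>)} \<and> (b \<in> {(\<kappa>, \<alpha>), (\<tau>, \<gamma>)} \<or>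
      b \<notin> {(\<kappa>, \<alpha>), (\<tau>, \<gamma>)} \<and> (\<forall>c\<in>{(\<kappa>, \<alpha>)}. (c, b) \<in> R'))"
    if "(a, b) \<in> R" "a \<in> {(\<kappa>, \<alpha>), (\<tau>, \<gamma>)}" for a b
  proof (cases "b \<in> {(\<kappa>, \<alpha>), (\<tau>, \<gamma>)}")
    case False
    then have "((\<kappa>, \<alpha>), b) \<in> R" using that trans_R[OF glued', of b] by auto
    then show ?thesis using False that(2) letters by (simp add: R'_def)
  qed (use that in simp)
  show "near {(\<kappa>, \<alpha>)} (j - 1) (retreat j L)" if "0 < j" for j L
    using that near_pat[of "j - 1" "{(\<kappa>, \<alpha>)}" "j - 1"]
    by (cases "j = 1") (auto simp: retreat_def near_def)
  show "near {(\<kappa>, \<alpha>)} m (retreat 0 L)" if "enat (m + 3) \<le> L" for m L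
    using that near_pat[of m "{(\<kappa>, \<alpha>)}" m]
    by (cases L; cases "m = 0")
      (auto simp: retreat_def near_def intro!: agree_mono[OF pat_near])
  show "agree m (retreat j L) (retreat j K) \<or> j = 0 \<and> (\<tau>, \<gamma>) \<in> {(\<kappa>, \<alpha>), (\<tau>, \<gamma>)}" for j m L K
    by (simp add: retreat_def)
qed auto

lemma retreat_advance: "rewrite retreat (rewrite advance x) = x"
proof -
  \<comment> \<open>With no gluing at all, survival for all \<open>k\<close> is equality of
    words.\<close>
  have "survives {} k (rewrite retreat (rewrite advance x)) x" for k
  proof (rule rewrite_inverse[OF good_out_advance good_out_retreat], rule disjI1)
    fix j L assume L: "enat (j + 3) \<le> L"
    show "\<exists>i. advance j L = pat i \<and> enat (i + 3) \<le> L \<and> retreat i L = pat j"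
    proof (cases "enat (j + 3) < L")
      case True
      then have "enat (Suc j + 3) \<le> L" by (cases L) auto
      then show ?thesis using True by (intro exI[of _ "Suc j"]) (simp add: advance_def retreat_def)
    next
      case False
      then have "L = enat (j + 3)" using L by simp
      then show ?thesis by (intro exI[of _ 0]) (simp add: advance_def retreat_def)
    qed
  qed
  then have "agree k (rewrite retreat (rewrite advance x)) x" for k
    by (rule survives_cases) (auto elim: agree_mono)
  then show ?thesis by (auto simp: agree_def)
qed

text \<open>Equality fails for tau gamma^inf: it is sent to kappa alpha^inf, which contains no block
  at its start and is fixed by \<open>advance\<close>. The two are glued in
  \<open>R\<close>.\<close>

lemma advance_retreat: "survives R k (rewrite advance (rewrite retreat x)) x"
proof (rule rewrite_inverse[OF good_out_retreat good_out_advance])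
  fix j L assume L: "enat (j + 3) \<le> L"
  show "(\<exists>i. retreat j L = pat i \<and> enat (i + 3) \<le> L \<and> advance i L = pat j) \<or>
    L = \<infinity> \<and> (\<forall>k. survives R k (rewrite advance (retreat j L)) (pat j))"
  proof (cases "0 < j")
    case True
    then have "enat (j - 1 + 3) < L" using L by (cases L) auto
    then show ?thesis using True by (intro disjI1 exI[of _ "j - 1"]) (simp add: advance_def retreat_def)
  next
    case j: False
    show ?thesis
    proof (cases L)
      case (enat l)
      then show ?thesis using j L by (intro disjI1 exI[of _ "l - 3"]) (simp add: advance_def retreat_def)
    next
      case infinity
      have "\<not> has_blk (corner (\<kappa>, \<alpha>))"
      proof
        assume "has_blk (corner (\<kappa>, \<alpha>))"
        then obtain i L where b: "blk (corner (\<kappa>, \<alpha>)) i L" by (auto simp: has_blk_def)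
        show False
          using blk_early[OF b, of 0] blk_early[OF b, of "Suc i"] letters
          by (auto simp: pat_def split: if_splits)
      qed
      then have "agree k (rewrite advance (corner (\<kappa>, \<alpha>))) (corner (\<kappa>, \<alpha>))" for k
        using rewrite_corner[of "Suc k" "corner (\<kappa>, \<alpha>)" "(\<kappa>, \<alpha>)"] by simp
      then have "survives R k (rewrite advance (corner (\<kappa>, \<alpha>))) (pat 0)" for k
        using adv.corner_survives[OF glued'] by (simp add: pat_0)
      then show ?thesis using infinity j by (simp add: retreat_def)
    qed
  qed
qed

end

section \<open>Lipschitz equivalence of quotients\<close>

text \<open>Distance 0 is preserved, so \<open>F\<close> and \<open>G\<close> descend to mutually
  inverse maps of classes. For the infima, representatives are moved by \<open>F\<close> in one
  direction and back into the original classes by \<open>G\<close> in the other.\<close>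

lemma lipschitz_quotient:
  fixes d1 :: "'a \<Rightarrow> 'a \<Rightarrow> real" and d2 :: "'b \<Rightarrow> 'b \<Rightarrow> real"
  assumes r1: "r1 = {(x, y). x \<in> W1 \<and> y \<in> W1 \<and> d1 x y = 0}" "equiv W1 r1"
    and r2: "r2 = {(x, y). x \<in> W2 \<and> y \<in> W2 \<and> d2 x y = 0}" "equiv W2 r2"
    and nonneg: "\<And>x y. 0 \<le> d1 x y" "\<And>x y. 0 \<le> d2 x y"
    and F: "\<And>x. x \<in> W1 \<Longrightarrow> F x \<in> W2" and G: "\<And>y. y \<in> W2 \<Longrightarrow> G y \<in> W1"
    and FF: "\<And>x y. d2 (F x) (F y) \<le> C * d1 x y"
    and GG: "\<And>x y. d1 (G x) (G y) \<le> C * d2 x y"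
    and GF: "\<And>x. d1 (G (F x)) x = 0" and FG: "\<And>y. d2 (F (G y)) y = 0" and C: "0 < C"
  shows "lipschitz_equiv (W1 // r1) (\<lambda>X Y. Inf {d1 a b | a b. a \<in> X \<and> b \<in> Y})
    (W2 // r2) (\<lambda>X Y. Inf {d2 a b | a b. a \<in> X \<and> b \<in> Y})"
proof -
  define f where "f X = r2 `` (F ` X)" for X
  define g where "g X = r1 `` (G ` X)" for X
  have F0: "(F x, F y) \<in> r2" if "(x, y) \<in> r1" for x y
    using that F FF[of x y] nonneg(2)[of "F x" "F y"] by (auto simp: r1(1) r2(1))
  have G0: "(G x, G y) \<in> r1" if "(x, y) \<in> r2" for x y
    using that G GG[of x y] nonneg(1)[of "G x" "G y"] by (auto simp: r1(1) r2(1))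
  have f_class: "f (r1 `` {x}) = r2 `` {F x}" if "x \<in> W1" for x
  proof
    show "f (r1 `` {x}) \<subseteq> r2 `` {F x}"
      using F0 r2(2) unfolding f_def equiv_def trans_def by blast
    show "r2 `` {F x} \<subseteq> f (r1 `` {x})"
      using that r1(2) unfolding f_def equiv_def refl_on_def by blast
  qed
  have g_class: "g (r2 `` {x}) = r1 `` {G x}" if "x \<in> W2" for x
  proof
    show "g (r2 `` {x}) \<subseteq> r1 `` {G x}"
      using G0 r1(2) unfolding g_def equiv_def trans_def by blast
    show "r1 `` {G x} \<subseteq> g (r2 `` {x})"
      using that r2(2) unfolding g_def equiv_def refl_on_def by blast
  qed
  have gf: "g (f X) = X" if "X \<in> W1 // r1" for X
  proof -
    obtain x where x: "x \<in> W1" "X = r1 `` {x}" using \<open>X \<in> W1 // r1\<close> by (elim quotientE)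
    have "(G (F x), x) \<in> r1" using x F G GF by (auto simp: r1(1))
    then show ?thesis using x f_class g_class F equiv_class_eq[OF r1(2)] by simp
  qed
  have fg: "f (g Y) = Y" if "Y \<in> W2 // r2" for Y
  proof -
    obtain y where y: "y \<in> W2" "Y = r2 `` {y}" using \<open>Y \<in> W2 // r2\<close> by (elim quotientE)
    have "(F (G y), y) \<in> r2" using y F G FG by (auto simp: r2(1))
    then show ?thesis using y f_class g_class G equiv_class_eq[OF r2(2)] by simp
  qed
  have fW: "f X \<in> W2 // r2" if "X \<in> W1 // r1" for X
    using that f_class F by (auto elim!: quotientE intro!: quotientI)
  have gW: "g X \<in> W1 // r1" if "X \<in> W2 // r2" for X
    using that g_class G by (auto elim!: quotientE intro!: quotientI)
  have bij: "bij_betw f (W1 // r1) (W2 // r2)"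
    using gf fg fW gW by (intro bij_betw_byWitness[where f' = g]) auto
  have Fmem: "F x \<in> f X" if "x \<in> X" "X \<in> W1 // r1" for x X
  proof -
    have "x \<in> W1" using that in_quotient_imp_subset[OF r1(2)] by blast
    then have "(F x, F x) \<in> r2" using F r2(2) unfolding equiv_def refl_on_def by blast
    then show ?thesis using that(1) by (auto simp: f_def)
  qed
  have Gmem: "G y \<in> X" if "y \<in> f X" "X \<in> W1 // r1" for y X
  proof -
    have "y \<in> W2" using that fW in_quotient_imp_subset[OF r2(2)] by blast
    then have "(G y, G y) \<in> r1" using G r1(2) unfolding equiv_def refl_on_def by blast
    then have "G y \<in> g (f X)" using that(1) by (auto simp: g_def)
    then show ?thesis using gf that(2) by simp
  qed
  have ne1: "X \<noteq> {}" if "X \<in> W1 // r1" for X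
    using that in_quotient_imp_non_empty[OF r1(2)] by blast
  have ne2: "f X \<noteq> {}" if "X \<in> W1 // r1" for X
    using that fW in_quotient_imp_non_empty[OF r2(2)] by blast
  have low1: "Inf {d1 a b | a b. a \<in> X \<and> b \<in> Y} \<le> d1 a b" if "a \<in> X" "b \<in> Y" for a b X Y
    using that nonneg(1) by (intro cInf_lower bdd_belowI[of _ 0]) auto
  have low2: "Inf {d2 a b | a b. a \<in> X \<and> b \<in> Y} \<le> d2 a b" if "a \<in> X" "b \<in> Y" for a b X Y
    using that nonneg(2) by (intro cInf_lower bdd_belowI[of _ 0]) auto
  have "Inf {d1 a b | a b. a \<in> X \<and> b \<in> Y} / C \<le> Inf {d2 a b | a b. a \<in> f X \<and> b \<in> f Y} \<and>
      Inf {d2 a b | a b. a \<in> f X \<and> b \<in> f Y} \<le> C * Inf {d1 a b | a b. a \<in> X \<and> b \<in> Y}"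
    if X: "X \<in> W1 // r1" and Y: "Y \<in> W1 // r1" for X Y
  proof
    show "Inf {d1 a b | a b. a \<in> X \<and> b \<in> Y} / C \<le> Inf {d2 a b | a b. a \<in> f X \<and> b \<in> f Y}"
    proof (rule cInf_greatest)
      fix t assume "t \<in> {d2 a b | a b. a \<in> f X \<and> b \<in> f Y}"
      then obtain a b where t: "t = d2 a b" "a \<in> f X" "b \<in> f Y" by blast
      have "Inf {d1 a b | a b. a \<in> X \<and> b \<in> Y} \<le> C * t"
        using low1[OF Gmem[OF t(2) X] Gmem[OF t(3) Y]] GG[of a b] t(1) by simp
      then show "Inf {d1 a b | a b. a \<in> X \<and> b \<in> Y} / C \<le> t"
        using C by (simp add: pos_divide_le_eq mult.commute)
    qed (use ne2[OF X] ne2[OF Y] in blast)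
    have "Inf {d2 a b | a b. a \<in> f X \<and> b \<in> f Y} / C \<le> Inf {d1 a b | a b. a \<in> X \<and> b \<in> Y}"
    proof (rule cInf_greatest)
      fix t assume "t \<in> {d1 a b | a b. a \<in> X \<and> b \<in> Y}"
      then obtain a b where t: "t = d1 a b" "a \<in> X" "b \<in> Y" by blast
      have "Inf {d2 a b | a b. a \<in> f X \<and> b \<in> f Y} \<le> C * t"
        using low2[OF Fmem[OF t(2) X] Fmem[OF t(3) Y]] FF[of a b] t(1) by simp
      then show "Inf {d2 a b | a b. a \<in> f X \<and> b \<in> f Y} / C \<le> t"
        using C by (simp add: pos_divide_le_eq mult.commute)
    qed (use ne1[OF X] ne1[OF Y] in blast)
    then show "Inf {d2 a b | a b. a \<in> f X \<and> b \<in> f Y} \<le> C * Inf {d1 a b | a b. a \<in> X \<and> b \<in> Y}"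
      using C by (simp add: pos_divide_le_eq mult.commute)
  qed
  then show ?thesis unfolding lipschitz_equiv_def using bij C by blast
qed

section \<open>Triangle automata\<close>

text \<open>The labels are crossed because the state \<open>S u v\<close> goes on reading
  \<open>(v, u)\<close>: the first word continues with \<open>v\<close>, the second with
  \<open>u\<close>.\<close>

definition Rel :: "tri \<Rightarrow> ((int \<times> int) \<times> (int \<times> int)) set" where
  "Rel M = {((i, v), (j, u)) | i v j u. (i, j) \<in> Puv M u v}"

lemma Rel_iff [simp]: "((i, v), (j, u)) \<in> Rel M \<longleftrightarrow> (i, j) \<in> Puv M u v"
  by (simp add: Rel_def)

lemma labels_distinct:
  "triangle_aut M \<Longrightarrow> al M \<noteq> be M \<and> al M \<noteq> ga M \<and> be M \<noteq> ga M"
  by (simp add: triangle_aut_def)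

lemma Puv_labels:
  assumes "triangle_aut M" "(i, j) \<in> Puv M u v"
  shows "u \<in> labels M \<and> v \<in> labels M \<and> u \<noteq> v"
  using assms(2) labels_distinct[OF assms(1)] by (auto simp: Puv_def labels_def split: if_splits)

lemma Puv_simps:
  assumes "triangle_aut M"
  shows "Puv M (al M) (be M) = Pab M" "Puv M (be M) (al M) = converse (Pab M)"
    "Puv M (al M) (ga M) = Pag M" "Puv M (ga M) (al M) = converse (Pag M)"
    "Puv M (be M) (ga M) = Pbg M" "Puv M (ga M) (be M) = converse (Pbg M)"
  using labels_distinct[OF assms] by (simp_all add: Puv_def)

lemma Puv_symD:
  assumes "triangle_aut M" "(i, j) \<in> Puv M u v"
  shows "(j, i) \<in> Puv M v u"
proof -
  consider "u = al M" "v = be M" | "u = be M" "v = al M" | "u = al M" "v = ga M"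
    | "u = ga M" "v = al M" | "u = be M" "v = ga M" | "u = ga M" "v = be M"
    using Puv_labels[OF assms] unfolding labels_def by blast
  then show ?thesis
    by cases (use assms(2) in \<open>simp_all add: Puv_simps[OF assms(1)]\<close>)
qed

lemma Puv_sym: "triangle_aut M \<Longrightarrow> (i, j) \<in> Puv M u v \<longleftrightarrow> (j, i) \<in> Puv M v u"
  using Puv_symD by blast

lemma Puv_letters:
  assumes "triangle_aut M" "(i, j) \<in> Puv M u v"
  shows "i \<in> Sig M \<and> j \<in> Sig M \<and> i \<noteq> j"
  using assms Puv_labels[OF assms] unfolding triangle_aut_def by blast

lemma Puv_disjoint:
  assumes "triangle_aut M" "(i, j) \<in> Puv M u v" "(i, j) \<in> Puv M u' v'"
  shows "u = u' \<and> v = v'"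
proof (rule ccontr)
  assume "\<not> (u = u' \<and> v = v')"
  then have "Puv M u v \<inter> Puv M u' v' = {}"
    using assms(1) Puv_labels[OF assms(1,2)] Puv_labels[OF assms(1,3)]
    unfolding triangle_aut_def by blast
  then show False using assms(2,3) by blast
qed

section \<open>Surviving times in terms of gluings\<close>

lemma delta_Id_eq_IdS: "delta_Id M i j = IdS \<longleftrightarrow> i = j"
  by (auto simp: delta_Id_def)

lemma delta_Id_eq_S:
  assumes "triangle_aut M"
  shows "delta_Id M i j = S u v \<longleftrightarrow> (i, j) \<in> Puv M u v"
proof
  have S: "(i, j) \<in> Puv M u v" if "delta_Id M i j = S u v" for u v
    using that by (auto simp: delta_Id_def split: if_splits)
  then show "(i, j) \<in> Puv M u v" if "delta_Id M i j = S u v" using that .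
  assume p: "(i, j) \<in> Puv M u v"
  have "delta_Id M i j \<noteq> IdS" using Puv_letters[OF assms p] by (simp add: delta_Id_eq_IdS)
  moreover have "delta_Id M i j \<noteq> ExitS"
    using p Puv_labels[OF assms p] by (auto simp: delta_Id_def labels_def)
  ultimately obtain u' v' where d: "delta_Id M i j = S u' v'" by (cases "delta_Id M i j") auto
  then show "delta_Id M i j = S u v" using Puv_disjoint[OF assms p S[OF d]] by simp
qed

lemma delta_eq_IdS: "delta M s i j = IdS \<longleftrightarrow> s = IdS \<and> i = j"
  by (cases s) (auto simp: delta_Id_eq_IdS)

lemma delta_eq_S:
  "triangle_aut M \<Longrightarrow> delta M s i j = S u v \<longleftrightarrow>
    s = IdS \<and> (i, j) \<in> Puv M u v \<or> s = S u v \<and> i = v \<and> j = u"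
  by (cases s) (auto simp: delta_Id_eq_S)

lemma itin_IdS: "itin M x y k = IdS \<longleftrightarrow> agree k x y"
  by (induction k) (auto simp: delta_eq_IdS agree_def less_Suc_eq)

lemma itin_S:
  assumes "triangle_aut M"
  shows "itin M x y k = S u v \<longleftrightarrow> (\<exists>n<k. agree n x y \<and> (x n, y n) \<in> Puv M u v \<and>
    (\<forall>l. n < l \<and> l < k \<longrightarrow> x l = v \<and> y l = u))"
proof (induction k)
  case (Suc k)
  have "itin M x y (Suc k) = S u v \<longleftrightarrow> agree k x y \<and> (x k, y k) \<in> Puv M u v \<or>
      (\<exists>n<k. agree n x y \<and> (x n, y n) \<in> Puv M u v \<and>
        (\<forall>l. n < l \<and> l < k \<longrightarrow> x l = v \<and> y l = u)) \<and> x k = v \<and> y k = u"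
    using Suc by (simp add: delta_eq_S[OF assms] itin_IdS)
  also have "\<dots> \<longleftrightarrow> (\<exists>n<Suc k. agree n x y \<and> (x n, y n) \<in> Puv M u v \<and>
    (\<forall>l. n < l \<and> l < Suc k \<longrightarrow> x l = v \<and> y l = u))"
    (is "?l \<longleftrightarrow> (\<exists>n<Suc k. ?P n)")
  proof
    assume ?l
    then show "\<exists>n<Suc k. ?P n"
    proof (elim disjE exE conjE)
      assume "agree k x y" "(x k, y k) \<in> Puv M u v"
      then show ?thesis by (intro exI[of _ k]) simp
    next
      fix n assume "n < k" "agree n x y" "(x n, y n) \<in> Puv M u v" "x k = v" "y k = u"
        "\<forall>l. n < l \<and> l < k \<longrightarrow> x l = v \<and> y l = u"
      then show ?thesis by (intro exI[of _ n]) (auto simp: less_Suc_eq)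
    qed
  next
    assume "\<exists>n<Suc k. ?P n"
    then obtain n where n: "n < Suc k" "?P n" by blast
    show ?l
    proof (cases "n = k")
      case True
      then show ?thesis using n by simp
    next
      case False
      then have "n < k" using n(1) by simp
      then have "?P n \<and> x k = v \<and> y k = u" using n(2) by simp
      then show ?thesis using \<open>n < k\<close> by (intro disjI2 conjI exI[of _ n]) simp_all
    qed
  qed
  finally show ?case .
qed simp

lemma agree_corner:
  "agree (k - n) (shift n x) (corner a) \<longleftrightarrow>
    (n < k \<longrightarrow> x n = fst a) \<and> (\<forall>l. n < l \<and> l < k \<longrightarrow> x l = snd a)"
proof -
  have "agree (k - n) (shift n x) (corner a) \<longleftrightarrow> (\<forall>l. n \<le> l \<and> l < k \<longrightarrow> x l = corner a (l - n))"
    unfolding agree_def shift_def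
    by (metis add_diff_cancel_left' le_add1 le_add_diff_inverse less_diff_conv2 add.commute less_diff_conv)
  also have "\<dots> \<longleftrightarrow> (n < k \<longrightarrow> x n = fst a) \<and> (\<forall>l. n < l \<and> l < k \<longrightarrow> x l = snd a)"
    by (auto simp: corner_def le_less)
  finally show ?thesis .
qed

lemma itin_survives:
  assumes "triangle_aut M"
  shows "itin M x y k \<noteq> ExitS \<longleftrightarrow> survives (Rel M) k x y"
proof
  assume a: "itin M x y k \<noteq> ExitS"
  show "survives (Rel M) k x y"
  proof (cases "itin M x y k")
    case IdS
    then show ?thesis using survives_agree itin_IdS by blast
  next
    case (S u v)
    then obtain n where n: "n < k" "agree n x y" "(x n, y n) \<in> Puv M u v"
      "\<forall>l. n < l \<and> l < k \<longrightarrow> x l = v \<and> y l = u" using itin_S[OF assms] by blast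
    show ?thesis
      by (rule survives_adjacent[OF n(2), of "(x n, v)" "(y n, u)"]) (use n in \<open>auto simp: agree_corner\<close>)
  qed (use a in simp)
next
  assume "survives (Rel M) k x y"
  then show "itin M x y k \<noteq> ExitS"
  proof (cases rule: survives_cases)
    case (1 n)
    then have "itin M x y k = IdS" using itin_IdS agree_mono by blast
    then show ?thesis by simp
  next
    case (2 n a b)
    then have "x n = fst a" "y n = fst b" "\<forall>l. n < l \<and> l < k \<longrightarrow> x l = snd a \<and> y l = snd b"
      by (auto simp: agree_corner)
    moreover have "(fst a, fst b) \<in> Puv M (snd b) (snd a)"
      using 2(3) by (cases a; cases b) simp
    ultimately have "itin M x y k = S (snd b) (snd a)"
      using 2(1,2) unfolding itin_S[OF assms] by auto
    then show ?thesis by simp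
  qed
qed

lemma rho_cases:
  assumes "triangle_aut M"
  obtains "\<forall>k. survives (Rel M) k x y" "rho M \<xi> x y = 0"
  | n where "survives (Rel M) n x y" "\<not> survives (Rel M) (Suc n) x y" "rho M \<xi> x y = \<xi> ^ n"
proof (cases "\<forall>k. survives (Rel M) k x y")
  case True
  then show ?thesis using that(1) itin_survives[OF assms] by (simp add: rho_def surv_def)
next
  case False
  then obtain m where m: "\<not> survives (Rel M) m x y" by blast
  have bound: "k \<le> m" if "survives (Rel M) k x y" for k
    using that m survives_mono[of "Rel M" k x y m] by (meson nat_le_linear)
  define g where "g = (GREATEST k. survives (Rel M) k x y)"
  have "survives (Rel M) g x y"
    unfolding g_def by (rule GreatestI_nat[where P = "\<lambda>k. survives (Rel M) k x y", OF survives_0 bound])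
  moreover have "\<not> survives (Rel M) (Suc g) x y"
    using Greatest_le_nat[of "\<lambda>k. survives (Rel M) k x y" "Suc g" m] bound g_def by force
  moreover have "surv M x y = enat g"
    unfolding surv_def itin_survives[OF assms] g_def using False by (rule if_not_P)
  then have "rho M \<xi> x y = \<xi> ^ g" by (simp add: rho_def)
  ultimately show ?thesis using that(2) by blast
qed

lemma rho_nonneg: "triangle_aut M \<Longrightarrow> 0 < \<xi> \<Longrightarrow> 0 \<le> rho M \<xi> x y"
  by (rule rho_cases[of M x y \<xi>]) auto

lemma rho_eq_0:
  assumes "triangle_aut M" "0 < \<xi>"
  shows "rho M \<xi> x y = 0 \<longleftrightarrow> (\<forall>k. survives (Rel M) k x y)"
  by (rule rho_cases[OF assms(1), of x y \<xi>]) (use assms(2) in auto)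

text \<open>Dying up to \<open>c\<close> letters earlier enlarges a power of \<open>\<xi>\<close> by
  at most \<open>1 / \<xi> ^ c\<close>.\<close>

lemma rho_le:
  assumes "triangle_aut M" "triangle_aut M'" "0 < \<xi>" "\<xi> < 1"
    and s: "\<And>k. survives (Rel M) k x y \<Longrightarrow> survives (Rel M') (k - c) x' y'"
  shows "rho M' \<xi> x' y' \<le> (1 / \<xi> ^ c) * rho M \<xi> x y"
proof (rule rho_cases[OF assms(1), of x y \<xi>])
  assume "\<forall>k. survives (Rel M) k x y" "rho M \<xi> x y = 0"
  then have "survives (Rel M') k x' y'" for k using s[of "k + c"] by simp
  then have "rho M' \<xi> x' y' = 0" using rho_eq_0[OF assms(2,3)] by blast
  then show ?thesis using \<open>rho M \<xi> x y = 0\<close> by simp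
next
  fix n assume n: "survives (Rel M) n x y" "rho M \<xi> x y = \<xi> ^ n"
  show ?thesis
  proof (rule rho_cases[OF assms(2), of x' y' \<xi>])
    assume "rho M' \<xi> x' y' = 0"
    then show ?thesis using n assms(3) by simp
  next
    fix m assume m: "\<not> survives (Rel M') (Suc m) x' y'" "rho M' \<xi> x' y' = \<xi> ^ m"
    have "n - c \<le> m"
      using m(1) survives_mono[OF s[OF n(1)], of "Suc m"] by (meson not_less_eq_eq)
    then have "n \<le> m + c" by simp
    then have "\<xi> ^ (m + c) \<le> \<xi> ^ n" using assms(3,4) by (intro power_decreasing) auto
    then show ?thesis using m n assms(3) by (simp add: pos_le_divide_eq power_add)
  qed
qed

section \<open>Gluings of a gasket automaton\<close>

lemma Puv_unique:
  assumes "gasket_aut M" "(i, j) \<in> Puv M u v" "(i, k) \<in> Puv M u v"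
  shows "j = k"
proof -
  have t: "triangle_aut M" using assms(1) by (simp add: gasket_aut_def)
  show ?thesis
    using assms Puv_labels[OF t assms(2)] unfolding gasket_aut_def by blast
qed

text \<open>The gathering condition freed from the order of the labels: it says that gluing of
  corners with three different labels is transitive. The six cases are the permutations of the
  labels.\<close>

lemma Puv_gather:
  assumes g: "gasket_aut M" and ij: "(i, j) \<in> Puv M u v" and jk: "(j, k) \<in> Puv M t u" and "v \<noteq> t"
  shows "(i, k) \<in> Puv M t v"
proof -
  have t: "triangle_aut M" using g by (simp add: gasket_aut_def)
  have sym: "(p, q) \<in> Puv M (be M) (al M) \<longleftrightarrow> (q, p) \<in> Puv M (al M) (be M)"
    "(p, q) \<in> Puv M (ga M) (al M) \<longleftrightarrow> (q, p) \<in> Puv M (al M) (ga M)"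
    "(p, q) \<in> Puv M (ga M) (be M) \<longleftrightarrow> (q, p) \<in> Puv M (be M) (ga M)" for p q
    using Puv_sym[OF t] by blast+
  have gather:
    "(a, c) \<in> Puv M (al M) (ga M) \<Longrightarrow> (a, b) \<in> Puv M (be M) (ga M) \<Longrightarrow> (b, c) \<in> Puv M (al M) (be M)"
    "(a, c) \<in> Puv M (al M) (ga M) \<Longrightarrow> (b, c) \<in> Puv M (al M) (be M) \<Longrightarrow> (a, b) \<in> Puv M (be M) (ga M)"
    "(a, b) \<in> Puv M (be M) (ga M) \<Longrightarrow> (b, c) \<in> Puv M (al M) (be M) \<Longrightarrow> (a, c) \<in> Puv M (al M) (ga M)"
    for a b c
    using g unfolding gasket_aut_def Let_def by blast+
  have "u \<in> {al M, be M, ga M}" "v \<in> {al M, be M, ga M}" "t \<in> {al M, be M, ga M}" "u \<noteq> v" "t \<noteq> u"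
    using Puv_labels[OF t ij] Puv_labels[OF t jk] by (auto simp: labels_def)
  then consider "u = al M" "v = be M" "t = ga M" | "u = al M" "v = ga M" "t = be M"
    | "u = be M" "v = al M" "t = ga M" | "u = be M" "v = ga M" "t = al M"
    | "u = ga M" "v = al M" "t = be M" | "u = ga M" "v = be M" "t = al M"
    using \<open>v \<noteq> t\<close> by blast
  then show ?thesis
    by cases (use ij jk in \<open>simp_all only: sym\<close>, (blast intro: gather)+)
qed

lemma Rel_sym: "triangle_aut M \<Longrightarrow> sym (Rel M)"
  by (rule symI) (auto simp: Rel_def dest: Puv_symD)

lemma Rel_irrefl: "triangle_aut M \<Longrightarrow> (a, b) \<in> Rel M \<Longrightarrow> fst a \<noteq> fst b"
  by (cases a; cases b) (auto dest: Puv_letters)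

text \<open>For outer corners with the same label uniqueness makes them equal; for different labels
  this is gathering.\<close>

lemma Rel_trans:
  assumes g: "gasket_aut M" and ab: "(a, b) \<in> Rel M" and bc: "(b, c) \<in> Rel M" and "a \<noteq> c"
  shows "(a, c) \<in> Rel M"
proof -
  have t: "triangle_aut M" using g by (simp add: gasket_aut_def)
  obtain i v j u k w where e: "a = (i, v)" "b = (j, u)" "c = (k, w)" by (metis prod.exhaust)
  have ij: "(i, j) \<in> Puv M u v" and jk: "(j, k) \<in> Puv M w u" using ab bc e by auto
  show ?thesis
  proof (cases "v = w")
    case True
    then have "i = k" using Puv_unique[OF g Puv_symD[OF t ij]] jk by simp
    then show ?thesis using True e \<open>a \<noteq> c\<close> by simp
  next
    case False
    then show ?thesis using Puv_gather[OF g ij jk] e by simp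
  qed
qed

text \<open>This is the boundary condition: a letter that is also the label \<open>v\<close> is
  minimal for both relations \<open>v u\<close>.\<close>

lemma Rel_diag_free:
  assumes "gasket_aut M" shows "((v, v), b) \<notin> Rel M"
proof
  assume "((v, v), b) \<in> Rel M"
  then obtain j u where p: "(v, j) \<in> Puv M u v" by (cases b) auto
  have t: "triangle_aut M" using assms by (simp add: gasket_aut_def)
  have "v \<in> Sig M" "(j, v) \<in> Puv M v u" "u \<in> labels M" "v \<in> labels M" "u \<noteq> v"
    using Puv_letters[OF t p] Puv_labels[OF t p] Puv_symD[OF t p] by simp_all
  then show False
    using assms unfolding gasket_aut_def minimal_def labels_def by blast
qed

lemma Rel_gamma_free:
  assumes "gasket_aut M" "gamma_isolated M" shows "((ga M, v), b) \<notin> Rel M"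
proof
  assume "((ga M, v), b) \<in> Rel M"
  then obtain j u where p: "(ga M, j) \<in> Puv M u v" by (cases b) auto
  have t: "triangle_aut M" using assms by (simp add: gasket_aut_def)
  have "(j, ga M) \<in> Puv M v u" "u \<in> labels M" "v \<in> labels M" "u \<noteq> v"
    using Puv_labels[OF t p] Puv_symD[OF t p] by simp_all
  then show False
    using p assms(2) unfolding gamma_isolated_def isolated_def minimal_def maximal_def labels_def by blast
qed

section \<open>Transfer to the automata\<close>

lemma simrel_eq:
  assumes "triangle_aut M" "0 < \<xi>"
  shows "simrel M \<xi> = {(x, y). x \<in> words M \<and> y \<in> words M \<and> (\<forall>k. survives (Rel M) k x y)}"
  using rho_eq_0[OF assms] by (auto simp: simrel_def)

text \<open>Transitivity is a premise because \<open>M'\<close> is treated only as a triangle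
  automaton; for it transitivity is obtained from \<open>M\<close>.\<close>

lemma equiv_simrel:
  assumes "triangle_aut M" "0 < \<xi>"
    and trans: "\<And>x y z k. (\<forall>k. survives (Rel M) k x y) \<Longrightarrow> (\<forall>k. survives (Rel M) k y z) \<Longrightarrow>
      survives (Rel M) k x z"
  shows "equiv (words M) (simrel M \<xi>)"
  unfolding simrel_eq[OF assms(1,2)]
proof (rule equivI)
  let ?r = "{(x, y). x \<in> words M \<and> y \<in> words M \<and> (\<forall>k. survives (Rel M) k x y)}"
  show "refl_on (words M) ?r" "?r \<subseteq> words M \<times> words M"
    by (auto simp: refl_on_def survives_agree)
  show "sym ?r" unfolding sym_def using survives_sym[OF Rel_sym[OF assms(1)]] by blast
  show "trans ?r" unfolding trans_def using trans by blast
qed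

text \<open>The label \<open>A\<close> covers both forms of the simplification at once: it plays the
  role of alpha in the blocks and may be either \<open>al M\<close> or \<open>be M\<close>.\<close>

lemma lipschitz_equiv_detach:
  assumes g: "gasket_aut M" and iso: "gamma_isolated M" and xi: "0 < \<xi>" "\<xi> < 1"
    and t': "triangle_aut M'" and sz: "sz M' = sz M"
    and A: "A = al M \<or> A = be M" and glued: "(\<tau>, \<kappa>) \<in> Puv M A (ga M)" and dm: "double_max M \<kappa>"
    and Rel': "Rel M' = {(a, b) \<in> Rel M. a \<noteq> (\<tau>, ga M) \<and> b \<noteq> (\<tau>, ga M)}"
  shows "lipschitz_equiv (AM M \<xi>) (rho_t M \<xi>) (AM M' \<xi>) (rho_t M' \<xi>)"
proof -
  have t: "triangle_aut M" using g by (simp add: gasket_aut_def)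
  note R = Rel_sym[OF t] Rel_irrefl[OF t] Rel_trans[OF g] Rel_diag_free[OF g] Rel_gamma_free[OF g iso]
  have glued_R: "((\<tau>, ga M), (\<kappa>, A)) \<in> Rel M" using glued by simp
  \<comment> \<open>Double-maximality of kappa: a gluing of \<open>(\<kappa>, \<gamma>)\<close>
    would be an edge out of kappa in one of the two relations toward gamma.\<close>
  have kappa_free: "((\<kappa>, ga M), b) \<notin> Rel M" for b
  proof
    assume "((\<kappa>, ga M), b) \<in> Rel M"
    then obtain j u where p: "(\<kappa>, j) \<in> Puv M u (ga M)" by (cases b) auto
    then show False
      using Puv_labels[OF t p] dm by (auto simp: double_max_def maximal_def labels_def)
  qed
  have letters_in: "A \<in> Sig M" "ga M \<in> Sig M" "\<tau> \<in> Sig M" "\<kappa> \<in> Sig M"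
    using iso A Puv_letters[OF t glued] by (auto simp: gamma_isolated_def)
  interpret detachment A "ga M" \<tau> \<kappa> "Rel M"
  proof
    show "\<tau> \<noteq> ga M" using glued_R R(5) by auto
    show "\<kappa> \<noteq> ga M" using symD[OF R(1) glued_R] R(5) by metis
    show "A \<noteq> ga M" using labels_distinct[OF t] A by auto
    show "\<kappa> \<noteq> A" using symD[OF R(1) glued_R] R(4) by metis
    show "\<kappa> \<noteq> \<tau>" using R(2)[OF glued_R] by simp
    show "(a, c) \<in> Rel M" if "(a, b) \<in> Rel M" "(b, c) \<in> Rel M" "a \<noteq> c" for a b c
      using R(3) that .
    show "fst a \<noteq> fst b" if "(a, b) \<in> Rel M" for a b using R(2) that .
  qed (rule R(1) R(4) R(5) kappa_free glued_R)+
  have R'_eq: "R' = Rel M'" by (simp add: R'_def Rel')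
  let ?F = "rewrite advance" and ?G = "rewrite retreat"
  have words: "words M' = words M" using sz by (simp add: words_def Sig_def)
  have pat_in: "pat j n \<in> Sig M" for j n using letters_in by (simp add: pat_def)
  have F_in: "?F x \<in> words M" if "x \<in> words M" for x
    using that pat_in rewrite_in[of advance "Sig M" x] by (simp add: words_def advance_def)
  have G_in: "?G x \<in> words M" if "x \<in> words M" for x
    using that pat_in letters_in rewrite_in[of retreat "Sig M" x]
    by (simp add: words_def retreat_def corner_def split: enat.split)
  have F_surv: "survives (Rel M) (k - 7) (?F x) (?F y)" if "survives (Rel M') k x y" for k x y
    using adv.rewrite_survives that by (simp add: R'_eq)
  have G_surv: "survives (Rel M') (k - 7) (?G x) (?G y)" if "survives (Rel M) k x y" for k x y
    using ret.rewrite_survives that by (simp add: R'_eq)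
  have trans_M: "survives (Rel M) k x z"
    if "\<forall>k. survives (Rel M) k x y" "\<forall>k. survives (Rel M) k y z" for x y z k
    by (rule survives_all_trans[OF _ _ _ _ that])
      (rule R(2), assumption, rule R(1), rule R(3), assumption+, rule R(4))
  \<comment> \<open>Infinite survival is carried to \<open>M\<close> by \<open>?F\<close>, composed
    there, and brought back by \<open>?G\<close>, which undoes \<open>?F\<close> exactly; adding 7
    compensates the loss.\<close>
  have trans_M': "survives (Rel M') k x z"
    if "\<forall>k. survives (Rel M') k x y" "\<forall>k. survives (Rel M') k y z" for x y z k
  proof -
    have F_all: "\<forall>k. survives (Rel M) k (?F x) (?F y)" if "\<forall>k. survives (Rel M') k x y" for x y
      using F_surv that by (metis diff_add_inverse2)
    have "survives (Rel M) (k + 7) (?F x) (?F z)"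
      using trans_M F_all that by blast
    then have "survives (Rel M') k (?G (?F x)) (?G (?F z))" using G_surv by fastforce
    then show ?thesis by (simp add: retreat_advance)
  qed
  have "lipschitz_equiv (words M // simrel M \<xi>) (\<lambda>X Y. Inf {rho M \<xi> a b | a b. a \<in> X \<and> b \<in> Y})
    (words M' // simrel M' \<xi>) (\<lambda>X Y. Inf {rho M' \<xi> a b | a b. a \<in> X \<and> b \<in> Y})"
  \<comment> \<open>The map from \<open>M\<close> to \<open>M'\<close> is \<open>?G\<close>, the
    retreat; it takes the place of \<open>F\<close> in the lemma, and \<open>?F\<close> that of
    \<open>G\<close>.\<close>
  proof (rule lipschitz_quotient)
    show "simrel M \<xi> = {(x, y). x \<in> words M \<and> y \<in> words M \<and> rho M \<xi> x y = 0}"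
      "simrel M' \<xi> = {(x, y). x \<in> words M' \<and> y \<in> words M' \<and> rho M' \<xi> x y = 0}"
      by (simp_all add: simrel_def)
    show "equiv (words M) (simrel M \<xi>)" "equiv (words M') (simrel M' \<xi>)"
      using equiv_simrel[OF t xi(1) trans_M] equiv_simrel[OF t' xi(1) trans_M'] by simp_all
    show "0 \<le> rho M \<xi> x y" "0 \<le> rho M' \<xi> x y" for x y
      using rho_nonneg t t' xi by auto
    show "?G x \<in> words M'" if "x \<in> words M" for x using G_in that words by simp
    show "?F x \<in> words M" if "x \<in> words M'" for x using F_in that words by simp
    show "rho M' \<xi> (?G x) (?G y) \<le> (1 / \<xi> ^ 7) * rho M \<xi> x y" for x y
      using rho_le[OF t t' xi] G_surv by blast
    show "rho M \<xi> (?F x) (?F y) \<le> (1 / \<xi> ^ 7) * rho M' \<xi> x y" for x y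
      using rho_le[OF t' t xi] F_surv by blast
    show "rho M \<xi> (?F (?G x)) x = 0" for x
      using rho_eq_0[OF t xi(1)] advance_retreat by blast
    show "rho M' \<xi> (?G (?F x)) x = 0" for x
      using rho_eq_0[OF t' xi(1)] by (simp add: retreat_advance survives_agree)
    show "0 < 1 / \<xi> ^ 7" using xi by simp
  qed
  then show ?thesis unfolding AM_def rho_t_def .
qed

lemma triangle_aut_subset:
  assumes t: "triangle_aut M" and eq: "al M' = al M" "be M' = be M" "ga M' = ga M" "sz M' = sz M"
    and sub: "\<And>u v. Puv M' u v \<subseteq> Puv M u v"
  shows "triangle_aut M'"
proof -
  have l: "labels M' = labels M" "Sig M' = Sig M" using eq by (simp_all add: labels_def Sig_def)
  have letters: "Puv M' u v \<subseteq> Sig M \<times> Sig M \<and> Puv M' u v \<inter> Id = {}" for u v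
  proof -
    have "i \<in> Sig M \<and> j \<in> Sig M \<and> i \<noteq> j" if "(i, j) \<in> Puv M' u v" for i j
      using Puv_letters[OF t] sub that by blast
    then show ?thesis by auto
  qed
  have disjoint: "Puv M' u v \<inter> Puv M' u' v' = {}" if "(u, v) \<noteq> (u', v')" for u v u' v'
  proof -
    have False if "(i, j) \<in> Puv M' u v" "(i, j) \<in> Puv M' u' v'" for i j
      using Puv_disjoint[OF t, of i j u v u' v'] sub that \<open>(u, v) \<noteq> (u', v')\<close> by blast
    then show ?thesis by auto
  qed
  have "distinct [al M, be M, ga M]" "labels M \<subseteq> Sig M \<union> {-1, -2, -3}"
    using t by (simp_all only: triangle_aut_def)
  then show ?thesis
    unfolding triangle_aut_def l eq using letters disjoint by blast
qed

text \<open>Removing the edges out of tau toward gamma is the same as freeing the corner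
  \<open>(\<tau>, \<gamma>)\<close>; the last conjunct handles the converse relations.\<close>

lemma Puv_detach:
  assumes t: "triangle_aut M" and eq: "al M' = al M" "be M' = be M" "ga M' = ga M" "Pab M' = Pab M"
    and Pag: "Pag M' = {p \<in> Pag M. fst p \<noteq> \<tau>}" and Pbg: "Pbg M' = {p \<in> Pbg M. fst p \<noteq> \<tau>}"
  shows "(i, j) \<in> Puv M' u v \<longleftrightarrow> (i, j) \<in> Puv M u v \<and> (i, v) \<noteq> (\<tau>, ga M) \<and> (j, u) \<noteq> (\<tau>, ga M)"
proof -
  have d: "al M \<noteq> be M" "al M \<noteq> ga M" "be M \<noteq> ga M" "be M \<noteq> al M" "ga M \<noteq> al M" "ga M \<noteq> be M"
    using labels_distinct[OF t] by auto
  consider "u = al M" "v = be M" | "u = be M" "v = al M" | "u = al M" "v = ga M"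
    | "u = ga M" "v = al M" | "u = be M" "v = ga M" | "u = ga M" "v = be M"
    | "\<not> (u = al M \<and> v = be M)" "\<not> (u = be M \<and> v = al M)" "\<not> (u = al M \<and> v = ga M)"
      "\<not> (u = ga M \<and> v = al M)" "\<not> (u = be M \<and> v = ga M)" "\<not> (u = ga M \<and> v = be M)"
    by blast
  then show ?thesis
  proof cases
    case 7
    then show ?thesis by (simp only: Puv_def eq prod.inject if_False empty_iff simp_thms)
  qed (simp_all add: Puv_def eq Pag Pbg d)
qed

theorem theorem1p2:
  fixes M M' :: tri and \<xi> :: real
  assumes "gasket_aut M"
    and "gamma_isolated M"
    and "Pag M \<union> Pbg M \<noteq> {}"
    and "one_step_simp M M'"
    and "0 < \<xi>" and "\<xi> < 1"
  shows "lipschitz_equiv (AM M \<xi>) (rho_t M \<xi>) (AM M' \<xi>) (rho_t M' \<xi>)"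
proof -
  note g = assms(1)
  have t: "triangle_aut M" using g by (simp add: gasket_aut_def)
  have d: "al M \<noteq> be M" "al M \<noteq> ga M" "be M \<noteq> ga M" using labels_distinct[OF t] by auto
  note P = Puv_simps[OF t]
  have uniq_ag: "j = k" if "(i, j) \<in> Pag M" "(i, k) \<in> Pag M" for i j k
    using Puv_unique[OF g, of i j "al M" "ga M" k] that P by simp
  have uniq_bg: "j = k" if "(i, j) \<in> Pbg M" "(i, k) \<in> Pbg M" for i j k
    using Puv_unique[OF g, of i j "be M" "ga M" k] that P by simp
  have uniq_ab: "i = k" if "(i, j) \<in> Pab M" "(k, j) \<in> Pab M" for i j k
    using Puv_unique[OF g, of j i "be M" "al M" k] that P by simp
  have uniq_ab': "j = k" if "(i, j) \<in> Pab M" "(i, k) \<in> Pab M" for i j k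
    using Puv_unique[OF g, of i j "al M" "be M" k] that P by simp
  have gather: "(b, c) \<in> Pab M" if "(a, c) \<in> Pag M" "(a, b) \<in> Pbg M" for a b c
    using Puv_gather[OF g, of b a "ga M" "be M" c "al M"] that P d by simp
  \<comment> \<open>All four forms of the simplification delete exactly the edges with first
    component tau from both relations toward gamma.\<close>
  obtain A \<tau> \<kappa> where A: "A = al M \<or> A = be M" "(\<tau>, \<kappa>) \<in> Puv M A (ga M)" "double_max M \<kappa>"
    and eq: "al M' = al M" "be M' = be M" "ga M' = ga M" "sz M' = sz M" "Pab M' = Pab M"
    and Pag: "Pag M' = {p \<in> Pag M. fst p \<noteq> \<tau>}" and Pbg: "Pbg M' = {p \<in> Pbg M. fst p \<noteq> \<tau>}"
  proof -
    obtain \<tau> \<kappa> where dm: "double_max M \<kappa>" and step: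
      "(\<tau>, \<kappa>) \<in> Pag M \<and>
         ((\<nexists>l. (l, \<kappa>) \<in> Pab M) \<and> M' = M\<lparr>Pag := Pag M - {(\<tau>, \<kappa>)}\<rparr> \<or>
          (\<exists>l. (l, \<kappa>) \<in> Pab M \<and> M' = M\<lparr>Pag := Pag M - {(\<tau>, \<kappa>)}, Pbg := Pbg M - {(\<tau>, l)}\<rparr>)) \<or>
       (\<tau>, \<kappa>) \<in> Pbg M \<and>
         ((\<nexists>l. (\<kappa>, l) \<in> Pab M) \<and> M' = M\<lparr>Pbg := Pbg M - {(\<tau>, \<kappa>)}\<rparr> \<or>
          (\<exists>l. (\<kappa>, l) \<in> Pab M \<and> M' = M\<lparr>Pbg := Pbg M - {(\<tau>, \<kappa>)}, Pag := Pag M - {(\<tau>, l)}\<rparr>))"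
      using assms(4)[unfolded one_step_simp_def P converse_iff] by (elim exE conjE)
    from step show thesis
    proof (elim disjE exE conjE)
      assume ag: "(\<tau>, \<kappa>) \<in> Pag M" "\<nexists>l. (l, \<kappa>) \<in> Pab M" "M' = M\<lparr>Pag := Pag M - {(\<tau>, \<kappa>)}\<rparr>"
      have "Pag M - {(\<tau>, \<kappa>)} = {p \<in> Pag M. fst p \<noteq> \<tau>}" by (auto dest: uniq_ag[OF ag(1)])
      \<comment> \<open>By gathering, an edge from tau in the other relation would end in an
        \<open>\<alpha>\<beta>\<close>-predecessor of kappa, and there is none.\<close>
      moreover have "Pbg M = {p \<in> Pbg M. fst p \<noteq> \<tau>}" using ag(2) gather[OF ag(1)] by force
      ultimately show thesis using that[of "al M" \<tau> \<kappa>] ag(1) dm P by (simp add: ag(3))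
    next
      fix l
      assume ag': "(\<tau>, \<kappa>) \<in> Pag M" "(l, \<kappa>) \<in> Pab M"
        "M' = M\<lparr>Pag := Pag M - {(\<tau>, \<kappa>)}, Pbg := Pbg M - {(\<tau>, l)}\<rparr>"
      have "Pag M - {(\<tau>, \<kappa>)} = {p \<in> Pag M. fst p \<noteq> \<tau>}" by (auto dest: uniq_ag[OF ag'(1)])
      \<comment> \<open>By gathering every edge from tau in the other relation ends in a predecessor
        of kappa, and uniqueness makes that predecessor \<open>l\<close>.\<close>
      moreover have "Pbg M - {(\<tau>, l)} = {p \<in> Pbg M. fst p \<noteq> \<tau>}"
        by (auto dest: uniq_ab[OF ag'(2) gather[OF ag'(1)]])
      ultimately show thesis using that[of "al M" \<tau> \<kappa>] ag'(1) dm P by (simp add: ag'(3))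
    next
      assume bg: "(\<tau>, \<kappa>) \<in> Pbg M" "\<nexists>l. (\<kappa>, l) \<in> Pab M" "M' = M\<lparr>Pbg := Pbg M - {(\<tau>, \<kappa>)}\<rparr>"
      have "Pbg M - {(\<tau>, \<kappa>)} = {p \<in> Pbg M. fst p \<noteq> \<tau>}" by (auto dest: uniq_bg[OF bg(1)])
      moreover have "Pag M = {p \<in> Pag M. fst p \<noteq> \<tau>}" using bg(2) gather[OF _ bg(1)] by force
      ultimately show thesis using that[of "be M" \<tau> \<kappa>] bg(1) dm P by (simp add: bg(3))
    next
      fix l
      assume bg': "(\<tau>, \<kappa>) \<in> Pbg M" "(\<kappa>, l) \<in> Pab M"
        "M' = M\<lparr>Pbg := Pbg M - {(\<tau>, \<kappa>)}, Pag := Pag M - {(\<tau>, l)}\<rparr>"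
      have "Pbg M - {(\<tau>, \<kappa>)} = {p \<in> Pbg M. fst p \<noteq> \<tau>}" by (auto dest: uniq_bg[OF bg'(1)])
      moreover have "Pag M - {(\<tau>, l)} = {p \<in> Pag M. fst p \<noteq> \<tau>}"
        by (auto dest: uniq_ab'[OF bg'(2) gather[OF _ bg'(1)]])
      ultimately show thesis using that[of "be M" \<tau> \<kappa>] bg'(1) dm P by (simp add: bg'(3))
    qed
  qed
  note detach = Puv_detach[OF t eq(1-3,5) Pag Pbg]
  have "Puv M' u v \<subseteq> Puv M u v" for u v using detach by auto
  then have "triangle_aut M'" by (rule triangle_aut_subset[OF t eq(1-4)])
  moreover have "Rel M' = {(a, b) \<in> Rel M. a \<noteq> (\<tau>, ga M) \<and> b \<noteq> (\<tau>, ga M)}"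
    using detach by (auto simp: Rel_def)
  ultimately show ?thesis
    using lipschitz_equiv_detach[OF assms(1,2,5,6) _ eq(4) A] by simp
qed

end
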